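(* Let $F\in\mathcal{S}$ and let $g_F$ be the screw function of $F$ (defined in the context). Suppose that there exists $t_0\ge 0$ such that $\Re(-g_F(t))\ge 0$ for all $t\ge t_0$, and that $s=1$ is not a zero of $F(s)$. Then there exists $\delta>0$ such that $F(s)$ has no zeros in the right half-plane $\Re(s)>1-\delta$.
   Context: The Selberg class $\mathcal{S}$ is the class of Dirichlet series $F(s)=\sum_{n\ge1}a_F(n)n^{-s}$ such that: (S1) the series converges absolutely for $\Re(s)>1$; (S2) there is an integer $m\ge 0$ such that $(s-1)^mF(s)$ extends to an entire function of finite order; the smallest such $m$ is denoted $\mathfrak{m}_F$; (S3) there are $r\ge 0$, $Q>0$, $\lambda_j>0$, $\mu_j\in\mathbb{C}$ with $\Re(\mu_j)\ge 0$ ($1\le j\le r$), and $\omega\in\mathbb{C}$ with $|\omega|=1$, such that $$\xi_F(s):=s^{\mathfrak{m}_F}(s-1)^{\mathfrak{m}_F}Q^s\prod_{j=1}^r\Gamma(\lambda_js+\mu_j)\,F(s)$$ satisfies $\xi_F(s)=\omega\,\overline{\xi_F(1-\bar s)}$; (S4) for every $\varepsilon>0$, $a_F(n)\ll_\varepsilon n^\varepsilon$; (S5) $\log F(s)=\sum_{n\ge1}b_F(n)n^{-s}$, where $b_F(n)=0$ unless $n=p^k$ with $p$ prime and $k\ge1$, and $b_F(n)\ll n^\theta$ for some $\theta<1/2$. The function $\xi_F$ is entire, and it is determined by $F$ up to a nonzero constant factor (independently of the choice of data in (S3)). Let $\Gamma_F$ be the set of all $\gamma\in\mathbb{C}$ with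 $\xi_F(1/2-i\gamma)=0$, and for $\gamma\in\Gamma_F$ let $m_\gamma$ be the multiplicity of $\gamma$ as a zero of $z\mapsto\xi_F(1/2-iz)$; put $m_0=0$ if $0\notin\Gamma_F$. Let $B_F$ be the constant (which is real) defined by $$iB_F=\lim_{z\to0}\left[\frac{\xi_F'}{\xi_F}\left(\frac12-iz\right)-\frac{im_0}{z}\right].$$ The screw function of $F$ is defined for $t\in\mathbb{R}$ by $$g_F(t):=-iB_Ft-\frac{m_0}{2}t^2+\sum_{\gamma\in\Gamma_F\setminus\{0\}}m_\gamma\frac{e^{-i\gamma t}-1}{\gamma^2}.$$ *)

theory Defs
  imports
    "HOL-Complex_Analysis.Complex_Analysis"
    "HOL-Library.Landau_Symbols"
begin

text \<open>
  The term at \<open>n = 0\<close> is zero, because \<open>0 powr s = 0\<close> and \<open>x / 0 = 0\<close>; so a series of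
  these terms over all of \<open>nat\<close> is the usual Dirichlet series over \<open>n \<ge> 1\<close>, and
  the value \<open>a 0\<close> plays no role.
\<close>
definition dirichlet_term :: "(nat \<Rightarrow> complex) \<Rightarrow> complex \<Rightarrow> nat \<Rightarrow> complex" where
  "dirichlet_term a s n = a n / of_nat n powr s"

definition finite_order :: "(complex \<Rightarrow> complex) \<Rightarrow> bool" where
  "finite_order G \<longleftrightarrow> (\<exists>\<rho> C :: real. \<forall>s. norm (G s) \<le> C * exp (norm s powr \<rho>))"

definition pole_cleared :: "(complex \<Rightarrow> complex) \<Rightarrow> nat \<Rightarrow> bool" where
  "pole_cleared F m \<longleftrightarrow>
     (\<exists>G. G holomorphic_on UNIV \<and> finite_order G \<and> (\<forall>s. s \<noteq> 1 \<longrightarrow> G s = (s - 1) ^ m * F s))"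

definition pole_exponent :: "(complex \<Rightarrow> complex) \<Rightarrow> nat" where
  "pole_exponent F = (LEAST m. pole_cleared F m)"

text \<open>
  The removable singularities are filled in by \<^const>\<open>remove_sings\<close>, because \<^const>\<open>Gamma\<close>
  takes the value \<open>0\<close> at its poles and \<open>F\<close> has a conventional value at \<open>s = 1\<close>.
\<close>
definition xi_of_data ::
    "(complex \<Rightarrow> complex) \<Rightarrow> nat \<Rightarrow> real \<Rightarrow> (nat \<Rightarrow> real) \<Rightarrow> (nat \<Rightarrow> complex) \<Rightarrow> complex \<Rightarrow> complex" where
  "xi_of_data F r Q l \<mu> = remove_sings (\<lambda>s.
     s ^ pole_exponent F * (s - 1) ^ pole_exponent F * of_real Q powr s *
     (\<Prod>j=1..r. Gamma (of_real (l j) * s + \<mu> j)) * F s)"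

definition is_xi :: "(complex \<Rightarrow> complex) \<Rightarrow> (complex \<Rightarrow> complex) \<Rightarrow> bool" where
  "is_xi F \<xi> \<longleftrightarrow>
     (\<exists>r Q l \<mu> \<omega>. Q > 0 \<and> (\<forall>j\<in>{1..r}. l j > 0 \<and> Re (\<mu> j) \<ge> 0) \<and> norm \<omega> = 1 \<and>
        \<xi> = xi_of_data F r Q l \<mu> \<and>
        (\<forall>s. \<xi> s = \<omega> * cnj (\<xi> (1 - cnj s))))"

text \<open>
  An element of the Selberg class is represented by its meromorphic continuation to the
  whole plane.  Nice meromorphy only fixes the value at \<open>s = 1\<close>: the limit if the
  singularity is removable, and \<open>0\<close> if \<open>1\<close> is a pole.  The last clause reads the
  identity for \<open>log F\<close> as one for a branch of the logarithm on \<open>Re s > 1\<close>.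
\<close>
definition selberg_class :: "(complex \<Rightarrow> complex) set" where
  "selberg_class = {F. F nicely_meromorphic_on UNIV \<and>
     (\<exists>a.
        (\<forall>s. Re s > 1 \<longrightarrow>
           summable (\<lambda>n. norm (dirichlet_term a s n)) \<and> dirichlet_term a s sums F s) \<and>
        (\<exists>m. pole_cleared F m) \<and>
        (\<exists>\<xi>. is_xi F \<xi>) \<and>
        (\<forall>\<epsilon>>0. (\<lambda>n. norm (a n)) \<in> O(\<lambda>n. real n powr \<epsilon>)) \<and>
        (\<exists>b.
           (\<forall>n\<ge>1. b n \<noteq> 0 \<longrightarrow> (\<exists>p k. prime p \<and> k \<ge> 1 \<and> n = p ^ k)) \<and>
           (\<exists>\<theta><1/2. (\<lambda>n. norm (b n)) \<in> O(\<lambda>n. real n powr \<theta>)) \<and>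
           (\<forall>s. Re s > 1 \<longrightarrow>
              (\<exists>L. dirichlet_term b s sums L \<and> exp L = F s))))}"

definition is_zero_of :: "(complex \<Rightarrow> complex) \<Rightarrow> complex \<Rightarrow> bool" where
  "is_zero_of F s \<longleftrightarrow> F s = 0 \<and> \<not> is_pole F s"

text \<open>
  Different data in the functional equation change \<open>\<xi>\<close> only by a nonzero constant factor,
  on which none of the notions below depend.
\<close>
definition xi :: "(complex \<Rightarrow> complex) \<Rightarrow> complex \<Rightarrow> complex" where
  "xi F = (SOME \<xi>. is_xi F \<xi>)"

definition xi_zeros :: "(complex \<Rightarrow> complex) \<Rightarrow> complex set" where
  "xi_zeros F = {\<gamma>. xi F (1/2 - \<i> * \<gamma>) = 0}"

definition xi_mult :: "(complex \<Rightarrow> complex) \<Rightarrow> complex \<Rightarrow> nat" where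
  "xi_mult F \<gamma> =
     (if \<gamma> \<in> xi_zeros F then nat (zorder (\<lambda>z. xi F (1/2 - \<i> * z)) \<gamma>) else 0)"

definition screw_B :: "(complex \<Rightarrow> complex) \<Rightarrow> real" where
  "screw_B F = (THE B.
     ((\<lambda>z. deriv (xi F) (1/2 - \<i> * z) / xi F (1/2 - \<i> * z) - \<i> * of_nat (xi_mult F 0) / z)
        \<longlongrightarrow> \<i> * of_real B) (at 0))"

definition screw_function :: "(complex \<Rightarrow> complex) \<Rightarrow> real \<Rightarrow> complex" where
  "screw_function F t =
     - \<i> * of_real (screw_B F) * of_real t - of_nat (xi_mult F 0) / 2 * of_real t ^ 2 +
     (\<Sum>\<^sub>\<infinity>\<gamma>\<in>xi_zeros F - {0}.
        of_nat (xi_mult F \<gamma>) * ((exp (- \<i> * \<gamma> * of_real t) - 1) / \<gamma> ^ 2))"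

end

theory Submission
  imports Defs
begin

text \<open>
  For a zero \<open>s = 1/2 + \<rho>\<close> of \<open>\<xi>\<close> put \<open>\<rho> = -\<i>\<gamma>\<close>.  The constant \<open>B\<close> is real, so
  \<open>Re (- g t) = m\<^sub>0 t\<^sup>2 / 2 + Re (\<Sum>\<rho>. m\<^sub>\<rho> (exp (\<rho> t) - 1) / \<rho>\<^sup>2)\<close>; the series converges
  absolutely because \<open>\<xi>\<close> has order at most \<open>3/2\<close>.  The Laplace transform of this function has
  simple poles at the \<open>\<rho>\<close> and their conjugates, with residues \<open>m\<^sub>\<rho> / (2 \<rho>\<^sup>2)\<close> that cannot cancel.
  Since the function is eventually nonnegative, Landau's theorem makes the abscissa of convergence a
  singularity on the real axis; as \<open>\<xi> 1 \<noteq> 0\<close>, a neighbourhood of \<open>1/2\<close> contains no \<open>\<rho>\<close>, and the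
  abscissa lies strictly to the left of \<open>1/2\<close>.

  No Hadamard product is needed: the Laplace transform is computed from the series itself.  Landau's
  theorem is used in the form of a comparison of the growth of the \<open>k\<close>-th moments
  \<open>\<integral> t\<^sup>k exp (-w t) h t dt\<close> at \<open>w\<close> and at \<open>Re w\<close> as \<open>k\<close> tends to infinity.
\<close>

subsection \<open>Zeros of entire functions of order less than two\<close>

text \<open>Two obstacles shape the proof. The class grants only some finite order for the
  continuation \<open>G\<close> cleared of its pole, whereas the weights
  \<open>1 / norm \<rho> ^ 2\<close> are summed by a zero count with exponent below 2. Good bounds
  exist on \<open>Re s \<ge> 2\<close>; the functional equation carries them to
  \<open>Re s \<le> -1\<close>, and Phragmen-Lindeloef closes the strip between, where the unknown
  order serves merely as a priori growth. The exponent 3/2 is what a crude bound for Gamma gives.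
  The second obstacle is Landau's theorem, usually shown by a Taylor expansion beyond the abscissa.
  Here all singularities are explicit, so rates can be compared directly: moments grow
  geometrically, at a rate set by the distance to the nearest pole. If no exponent is within
  \<open>R\<close> of 1/2, a real point at most \<open>R / 4\<close> to the right of 1/2 is at least
  \<open>3 * R / 4\<close> away from all of them, while a point over the forbidden strip of width
  \<open>R / 4\<close> can be brought within \<open>3 * R / 8\<close> of one. The initial segment up
  to \<open>t0\<close>, where the sign is unknown, costs \<open>t0 ^ (k + 1) / k!\<close>, which is
  negligible against any geometric rate.\<close>

lemma holomorphic_divide_out_zeros:
  fixes f :: "complex \<Rightarrow> complex"
  assumes f: "f holomorphic_on UNIV" and nz: "f c \<noteq> 0" and "finite S"
  obtains g where "g holomorphic_on UNIV" "\<And>z. f z = (\<Prod>a\<in>S. (z - a) ^ nat (zorder f a)) * g z"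
proof -
  have "\<exists>g. g holomorphic_on UNIV \<and> (\<forall>z. f z = (\<Prod>a\<in>S. (z - a) ^ nat (zorder f a)) * g z)"
    using \<open>finite S\<close>
  proof induction
    case empty
    then show ?case using f by auto
  next
    case (insert b S)
    then obtain g where g: "g holomorphic_on UNIV" "\<And>z. f z = (\<Prod>a\<in>S. (z - a) ^ nat (zorder f a)) * g z"
      by blast
    define P where "P = (\<lambda>z. \<Prod>a\<in>S. (z - a) ^ nat (zorder f a))"
    have f_eq: "f z = P z * g z" for z
      using g(2) by (simp add: P_def)
    define n where "n = nat (zorder f b)"
    obtain r where r: "r > 0" "zor_poly f b holomorphic_on cball b r"
        "\<And>w. w \<in> cball b r \<Longrightarrow> f w = zor_poly f b w * (w - b) ^ n"
    proof -
      have "\<exists>w\<in>UNIV. f w \<noteq> 0" using nz by blast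
      from zorder_exist_zero[OF f open_UNIV connected_UNIV UNIV_I this] that show ?thesis
        unfolding n_def by blast
    qed
    obtain r' where r': "r' > 0" "\<And>w. w \<in> ball b r' \<Longrightarrow> w \<notin> S"
      using finite_imp_closed[OF \<open>finite S\<close>] \<open>b \<notin> S\<close> open_contains_ball[of "- S"] by (auto simp: subset_iff)
    define \<delta> where "\<delta> = min r r'"
    have "\<delta> > 0" using r r' by (simp add: \<delta>_def)
    have P_nz: "P w \<noteq> 0" if "w \<in> ball b \<delta>" for w
      using r'(2)[of w] that \<open>finite S\<close> by (auto simp: P_def \<delta>_def)
    have P_hol: "P holomorphic_on A" for A
      unfolding P_def by (intro holomorphic_intros)
    \<comment> \<open>The order is taken from \<open>f\<close>, not from \<open>g\<close>; this is
      harmless because \<open>P\<close> has no zero near \<open>b\<close>. The first formula gives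
      holomorphy near \<open>b\<close>, the second away from it.\<close>
    define g' where "g' = (\<lambda>z. if z = b then zor_poly f b z / P z else g z / (z - b) ^ n)"
    have g'_near: "g' w = zor_poly f b w / P w" if "w \<in> ball b \<delta>" for w
      using f_eq[of w] r(3)[of w] P_nz[OF that] that
      by (auto simp: g'_def \<delta>_def field_simps)
    have "g' holomorphic_on (ball b \<delta> \<union> (- {b}))"
    proof (rule holomorphic_on_Un)
      have "(\<lambda>w. zor_poly f b w / P w) holomorphic_on ball b \<delta>"
        using P_nz by (intro holomorphic_intros P_hol holomorphic_on_subset[OF r(2)]) (auto simp: \<delta>_def)
      then show "g' holomorphic_on ball b \<delta>"
        by (rule holomorphic_transform) (use g'_near in auto)
      have "(\<lambda>z. g z / (z - b) ^ n) holomorphic_on - {b}"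
        by (intro holomorphic_intros holomorphic_on_subset[OF g(1)]) auto
      then show "g' holomorphic_on - {b}"
        by (rule holomorphic_transform) (auto simp: g'_def)
    qed auto
    moreover have "ball b \<delta> \<union> (- {b}) = UNIV" using \<open>\<delta> > 0\<close> by auto
    ultimately have g'_hol: "g' holomorphic_on UNIV" by (simp only:)
    have f_g': "f z = (\<Prod>a\<in>insert b S. (z - a) ^ nat (zorder f a)) * g' z" for z
    proof -
      have prod: "(\<Prod>a\<in>insert b S. (z - a) ^ nat (zorder f a)) = (z - b) ^ n * P z"
        using insert.hyps by (simp add: P_def n_def)
      show ?thesis
      proof (cases "z = b")
        case True
        have "b \<in> ball b \<delta>" "b \<in> cball b r" using \<open>\<delta> > 0\<close> r by auto
        then show ?thesis
          unfolding prod using r(3)[of b] P_nz[of b] True by (simp add: g'_def)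
      next
        case False
        then show ?thesis unfolding prod using f_eq[of z] by (simp add: g'_def)
      qed
    qed
    show ?case by (intro exI[of _ g'] conjI allI g'_hol f_g')
  qed
  then show ?thesis using that by blast
qed

text \<open>A crude Jensen inequality: a point of \<open>S\<close> is at distance at least
  \<open>2 * R\<close> from the circle of radius \<open>3 * R\<close>, but at most \<open>R\<close>
  from \<open>c\<close>. By the maximum principle for the quotient, each zero costs a factor of
  2.\<close>

lemma zero_count_le:
  fixes f :: "complex \<Rightarrow> complex"
  assumes f: "f holomorphic_on UNIV" and nz: "f c \<noteq> 0" and "finite S" and S: "S \<subseteq> cball c R" and "R > 0"
    and M: "\<And>z. norm (z - c) = 3 * R \<Longrightarrow> norm (f z) \<le> M"
  shows "2 ^ (\<Sum>a\<in>S. nat (zorder f a)) * norm (f c) \<le> M"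
proof -
  let ?n = "\<lambda>a. nat (zorder f a)" and ?N = "\<Sum>a\<in>S. nat (zorder f a)"
  obtain g where g: "g holomorphic_on UNIV" "\<And>z. f z = (\<Prod>a\<in>S. (z - a) ^ ?n a) * g z"
    using holomorphic_divide_out_zeros[OF f nz \<open>finite S\<close>] by blast
  have "norm (g c) \<le> M / (2 * R) ^ ?N"
  proof (rule maximum_modulus_frontier[of g "cball c (3 * R)"])
    fix z assume "z \<in> frontier (cball c (3 * R))"
    then have z: "norm (z - c) = 3 * R" by (simp add: dist_norm norm_minus_commute)
    have "2 * R \<le> norm (z - a)" if "a \<in> S" for a
    proof -
      have "norm (a - c) \<le> R" using S that by (auto simp: dist_norm norm_minus_commute)
      then show ?thesis using z norm_triangle_ineq4[of "z - a" "c - a"] norm_minus_commute[of a c] by simp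
    qed
    then have "(2 * R) ^ ?N \<le> norm (\<Prod>a\<in>S. (z - a) ^ ?n a)"
      unfolding power_sum prod_norm[symmetric] norm_power
      by (intro prod_mono conjI power_mono) (use \<open>R > 0\<close> in auto)
    then have "(2 * R) ^ ?N * norm (g z) \<le> norm (f z)"
      unfolding g(2)[of z] norm_mult by (intro mult_right_mono) auto
    also have "\<dots> \<le> M" by (rule M[OF z])
    finally show "norm (g z) \<le> M / (2 * R) ^ ?N"
      using \<open>R > 0\<close> by (simp add: field_simps)
  qed (use \<open>R > 0\<close> in \<open>auto intro!: holomorphic_on_subset[OF g(1)] holomorphic_on_imp_continuous_on\<close>)
  moreover have "norm (\<Prod>a\<in>S. (c - a) ^ ?n a) \<le> R ^ ?N"
    unfolding power_sum prod_norm[symmetric] norm_power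
    by (intro prod_mono) (use S in \<open>auto intro!: power_mono simp: dist_norm\<close>)
  ultimately have "norm (f c) \<le> R ^ ?N * (M / (2 * R) ^ ?N)"
    unfolding g(2)[of c] norm_mult using \<open>R > 0\<close> by (intro mult_mono) auto
  then show ?thesis
    using \<open>R > 0\<close> by (simp add: power_mult_distrib field_simps)
qed

text \<open>The term of the least \<open>j\<close> with \<open>x \<le> 2 ^ j\<close> suffices, since
  then \<open>x > 2 ^ (j - 1)\<close>. The sum over all \<open>j\<close> is there so that it can be
  interchanged with a sum over zeros, in place of partial summation.\<close>

lemma inverse_square_le_dyadic:
  fixes x :: real
  assumes x: "1 < x" "x \<le> 2 ^ J"
  shows "1 / x ^ 2 \<le> (\<Sum>j\<le>J. if x \<le> 2 ^ j then 4 / 4 ^ j else 0)"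
proof -
  define j where "j = (LEAST j. x \<le> 2 ^ j)"
  have j: "x \<le> 2 ^ j" unfolding j_def using x(2) by (rule LeastI)
  have "j \<le> J" unfolding j_def using x(2) by (rule Least_le)
  have "j \<noteq> 0" using j x by (cases j) auto
  then obtain i where i: "j = Suc i" by (cases j) auto
  have "\<not> x \<le> 2 ^ i" using not_less_Least[of i "\<lambda>j. x \<le> 2 ^ j"] i by (simp add: j_def)
  then have "(2 ^ i) ^ 2 \<le> x ^ 2" by (intro power_mono) auto
  then have "4 ^ i \<le> x ^ 2" by (simp add: power2_eq_square power_mult_distrib[symmetric])
  then have "1 / x ^ 2 \<le> 1 / 4 ^ i" using x by (intro divide_left_mono) auto
  also have "\<dots> = (if x \<le> 2 ^ j then 4 / 4 ^ j else 0)" using j i by simp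
  also have "\<dots> \<le> (\<Sum>j\<le>J. if x \<le> 2 ^ j then 4 / 4 ^ j else 0)"
    by (rule member_le_sum) (use \<open>j \<le> J\<close> in auto)
  finally show ?thesis .
qed

text \<open>Doubling the radius moves the centre from 0 to \<open>c\<close>. On the circle of radius
  \<open>6 * R\<close> about \<open>c\<close> one has \<open>1 + norm z \<le> 8 * R\<close>, hence
  the constant 8.\<close>

lemma zero_count_growth:
  fixes f :: "complex \<Rightarrow> complex"
  assumes f: "f holomorphic_on UNIV" and nz: "f c \<noteq> 0" and "p \<ge> 0"
    and growth: "\<And>z. norm (f z) \<le> exp (A * (1 + norm z) powr p)"
  obtains K where "\<And>R S. 1 \<le> R \<Longrightarrow> norm c \<le> R \<Longrightarrow> finite S \<Longrightarrow> S \<subseteq> cball 0 R \<Longrightarrow>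
      real (\<Sum>a\<in>S. nat (zorder f a)) \<le> K * R powr p" "K \<ge> 0"
proof
  let ?B = "\<bar>A\<bar>"
  let ?K = "(\<bar>ln (norm (f c))\<bar> + ?B * 8 powr p) / ln 2"
  show "?K \<ge> 0" by simp
  fix R :: real and S :: "complex set"
  assume R: "1 \<le> R" "norm c \<le> R" and S: "finite S" "S \<subseteq> cball 0 R"
  let ?N = "\<Sum>a\<in>S. nat (zorder f a)"
  have "2 ^ ?N * norm (f c) \<le> exp (?B * (8 * R) powr p)"
  proof (rule zero_count_le[OF f nz S(1), of "2 * R"])
    show "S \<subseteq> cball c (2 * R)"
    proof
      fix a assume "a \<in> S"
      then have "norm a \<le> R" using S by auto
      then show "a \<in> cball c (2 * R)"
        using norm_triangle_ineq4[of c a] R by (simp add: dist_norm)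
    qed
    fix z assume z: "norm (z - c) = 3 * (2 * R)"
    have "1 + norm z \<le> 8 * R" using z R norm_triangle_ineq[of "z - c" c] by simp
    then have "(1 + norm z) powr p \<le> (8 * R) powr p"
      using \<open>p \<ge> 0\<close> by (intro powr_mono2) auto
    then have "A * (1 + norm z) powr p \<le> ?B * (8 * R) powr p"
      by (intro mult_mono) auto
    then show "norm (f z) \<le> exp (?B * (8 * R) powr p)"
      using growth[of z] by (meson exp_le_cancel_iff order_trans)
  qed (use R in auto)
  moreover have fc: "norm (f c) > 0" using nz by simp
  ultimately have "ln (2 ^ ?N * norm (f c)) \<le> ln (exp (?B * (8 * R) powr p))"
    by (subst ln_le_cancel_iff) auto
  then have "real ?N * ln 2 + ln (norm (f c)) \<le> ?B * (8 * R) powr p"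
    using fc unfolding ln_exp by (simp add: ln_mult ln_realpow)
  then have "real ?N * ln 2 \<le> \<bar>ln (norm (f c))\<bar> * 1 + ?B * 8 powr p * R powr p"
    using R by (simp add: powr_mult)
  also have "\<dots> \<le> \<bar>ln (norm (f c))\<bar> * R powr p + ?B * 8 powr p * R powr p"
    using R \<open>p \<ge> 0\<close> by (intro add_right_mono mult_left_mono) (auto intro: ge_one_powr_ge_zero)
  finally show "real ?N \<le> ?K * R powr p"
    by (simp add: field_simps)
qed

text \<open>The count at radius \<open>2 ^ j\<close> times the weight \<open>4 / 4 ^ j\<close> is
  geometric with ratio \<open>q\<close>, and \<open>q < 1\<close> because \<open>p < 2\<close>. A
  zero at the origin has weight 0 by the convention for division.\<close>

lemma summable_on_zeros:
  fixes f :: "complex \<Rightarrow> complex"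
  assumes f: "f holomorphic_on UNIV" and nz: "f c \<noteq> 0" and p: "0 \<le> p" "p < 2"
    and growth: "\<And>z. norm (f z) \<le> exp (A * (1 + norm z) powr p)"
  shows "(\<lambda>a. real (nat (zorder f a)) / norm a ^ 2) summable_on {a. f a = 0}"
proof -
  let ?h = "\<lambda>a. real (nat (zorder f a)) / norm a ^ 2"
  obtain K where K: "\<And>R S. 1 \<le> R \<Longrightarrow> norm c \<le> R \<Longrightarrow> finite S \<Longrightarrow> S \<subseteq> cball 0 R \<Longrightarrow>
      real (\<Sum>a\<in>S. nat (zorder f a)) \<le> K * R powr p" "K \<ge> 0"
    using zero_count_growth[OF f nz p(1) growth] by blast
  \<comment> \<open>The counting lemma needs radii at least 1 and \<open>norm c\<close>. Zeros
    beyond \<open>r\<close> only meet powers of 2 that satisfy both.\<close>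
  define r where "r = max 1 (norm c)"
  define q :: real where "q = 2 powr p / 4"
  have "(2::real) powr p < 2 powr 2" using p by (intro powr_less_mono) auto
  then have q: "0 \<le> q" "q < 1" by (auto simp: q_def)
  let ?Z1 = "{a \<in> cball 0 r. f a = 0}" and ?Z2 = "{a. f a = 0 \<and> norm a > r}"
  have "finite ?Z1"
  proof (cases "f constant_on UNIV")
    case True
    then have "?Z1 = {}" using nz by (auto simp: constant_on_def)
    then show ?thesis by (simp only: finite.emptyI)
  next
    case False
    then show ?thesis by (intro holomorphic_compact_finite_zeros[OF f]) auto
  qed
  then have "?h summable_on ?Z1" by (rule summable_on_finite)
  moreover have "?h summable_on ?Z2"
  proof (rule nonneg_bdd_above_summable_on)
    show "bdd_above (sum ?h ` {S. S \<subseteq> ?Z2 \<and> finite S})"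
    proof (rule bdd_aboveI2)
      fix S assume "S \<in> {S. S \<subseteq> ?Z2 \<and> finite S}"
      then have S: "S \<subseteq> ?Z2" "finite S" by auto
      have "\<exists>J::nat. \<forall>a\<in>S. norm a \<le> 2 ^ J"
      proof -
        obtain B where B: "\<And>a. a \<in> S \<Longrightarrow> norm a \<le> B"
          using finite_imp_bounded[OF S(2)] by (auto simp: bounded_iff)
        obtain J where "B < 2 ^ J" using real_arch_pow[of 2 B] by auto
        then show ?thesis using B by (intro exI[of _ J]) (meson less_imp_le order_trans)
      qed
      then obtain J :: nat where J: "\<And>a. a \<in> S \<Longrightarrow> norm a \<le> 2 ^ J" by blast
      have "sum ?h S \<le> (\<Sum>a\<in>S. real (nat (zorder f a)) * (\<Sum>j\<le>J. if norm a \<le> 2 ^ j then 4 / 4 ^ j else 0))"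
      proof (rule sum_mono)
        fix a assume "a \<in> S"
        then have "1 < norm a" "norm a \<le> 2 ^ J" using S J by (auto simp: r_def)
        from mult_left_mono[OF inverse_square_le_dyadic[OF this], of "real (nat (zorder f a))"]
        show "?h a \<le> real (nat (zorder f a)) * (\<Sum>j\<le>J. if norm a \<le> 2 ^ j then 4 / 4 ^ j else 0)"
          by simp
      qed
      also have "\<dots> = (\<Sum>j\<le>J. \<Sum>a\<in>S. real (nat (zorder f a)) * (if norm a \<le> 2 ^ j then 4 / 4 ^ j else 0))"
        unfolding sum_distrib_left by (rule sum.swap)
      also have "\<dots> \<le> (\<Sum>j\<le>J. 4 * K * q ^ j)"
      proof (rule sum_mono)
        fix j
        let ?S = "{a \<in> S. norm a \<le> 2 ^ j}"
        have "(\<Sum>a\<in>S. real (nat (zorder f a)) * (if norm a \<le> 2 ^ j then 4 / 4 ^ j else 0)) =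
            (\<Sum>a\<in>?S. real (nat (zorder f a)) * (4 / 4 ^ j))"
          using S(2) by (intro sum.mono_neutral_cong_right) auto
        also have "\<dots> = real (\<Sum>a\<in>?S. nat (zorder f a)) * (4 / 4 ^ j)"
          by (simp only: of_nat_sum sum_distrib_right)
        also have "\<dots> \<le> K * (2 ^ j) powr p * (4 / 4 ^ j)"
        proof (intro mult_right_mono)
          show "real (\<Sum>a\<in>?S. nat (zorder f a)) \<le> K * (2 ^ j) powr p"
          proof (cases "?S = {}")
            case True
            then show ?thesis using K(2) by (simp only: sum.empty) simp
          next
            case False
            then obtain a where "a \<in> S" "norm a \<le> 2 ^ j" by blast
            then have "norm c \<le> 2 ^ j" using S(1) by (force simp: r_def)
            then show ?thesis using S(2) by (intro K(1)) auto
          qed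
        qed auto
        also have "(2 ^ j) powr p = (2 powr p) ^ j"
        proof -
          have "(2 ^ j) powr p = (2 powr real j) powr p" by (simp add: powr_realpow)
          also have "\<dots> = (2 powr p) powr real j" by (simp add: powr_powr mult.commute)
          finally show ?thesis by (simp add: powr_realpow)
        qed
        finally show "(\<Sum>a\<in>S. real (nat (zorder f a)) * (if norm a \<le> 2 ^ j then 4 / 4 ^ j else 0)) \<le> 4 * K * q ^ j"
          by (simp add: q_def power_divide mult_ac)
      qed
      also have "\<dots> = 4 * K * (\<Sum>j\<le>J. q ^ j)"
        by (simp add: sum_distrib_left)
      also have "\<dots> \<le> 4 * K * (1 / (1 - q))"
      proof (intro mult_left_mono)
        show "(\<Sum>j\<le>J. q ^ j) \<le> 1 / (1 - q)"
          using sum_le_suminf[of "\<lambda>j. q ^ j" "{..J}"] q by (simp add: suminf_geometric summable_geometric)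
      qed (use K(2) in auto)
      finally show "sum ?h S \<le> 4 * K * (1 / (1 - q))" .
    qed
  qed auto
  moreover have "{a. f a = 0} = ?Z1 \<union> ?Z2" by auto
  moreover have "?Z1 \<inter> ?Z2 = {}" by auto
  ultimately show ?thesis
    using summable_on_Un_disjoint[of ?h ?Z1 ?Z2] by (simp only:)
qed

subsection \<open>A Phragmen--Lindeloef theorem for vertical strips\<close>

text \<open>The factor \<open>exp (- \<epsilon> * cos (\<delta> * s))\<close> damps any growth of
  finite order, since the real part of the cosine grows exponentially with
  \<open>\<bar>Im s\<bar>\<close>. The maximum principle on a tall rectangle bounds the product, and
  then \<open>\<epsilon>\<close> tends to 0.\<close>

lemma phragmen_lindelof_strip:
  fixes f :: "complex \<Rightarrow> complex"
  assumes "B > 0" "C > 0" and f: "f holomorphic_on U" and U: "open U" "{s. \<bar>Re s\<bar> \<le> B} \<subseteq> U"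
    and side: "\<And>s. \<bar>Re s\<bar> = B \<Longrightarrow> norm (f s) \<le> C"
    and growth: "\<And>s. \<bar>Re s\<bar> \<le> B \<Longrightarrow> norm (f s) \<le> exp (A * (1 + norm s) powr p)"
    and z: "\<bar>Re z\<bar> \<le> B"
  shows "norm (f z) \<le> C"
proof -
  \<comment> \<open>This keeps \<open>\<delta> * Re s\<close> within pi/3 of 0, where the real
    cosine is at least 1/2.\<close>
  define \<delta> where "\<delta> = pi / (3 * B)"
  have "\<delta> > 0" using \<open>B > 0\<close> by (simp add: \<delta>_def)
  have Re_cos_eq: "Re (cos (of_real \<delta> * s)) = cos (\<delta> * Re s) * ((exp (\<delta> * Im s) + exp (- (\<delta> * Im s))) / 2)" for s
    by (simp add: Re_cos)
  have cos_ge: "1 / 2 \<le> cos (\<delta> * Re s)" if "\<bar>Re s\<bar> \<le> B" for s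
  proof -
    have "\<bar>\<delta> * Re s\<bar> \<le> \<delta> * B" using that \<open>\<delta> > 0\<close> by (simp add: abs_mult)
    also have "\<delta> * B = pi / 3" using \<open>B > 0\<close> by (simp add: \<delta>_def)
    finally have "cos (pi / 3) \<le> cos \<bar>\<delta> * Re s\<bar>"
      using pi_ge_two by (intro cos_monotone_0_pi_le) auto
    then show ?thesis by (simp add: cos_60)
  qed
  have exp_le: "exp (\<delta> * \<bar>y\<bar>) \<le> exp (\<delta> * y) + exp (- (\<delta> * y))" for y
    by (cases "y \<ge> 0") auto
  have Re_cos_ge: "exp (\<delta> * \<bar>Im s\<bar>) / 4 \<le> Re (cos (of_real \<delta> * s))" if "\<bar>Re s\<bar> \<le> B" for s
  proof -
    have "1 / 2 * (exp (\<delta> * \<bar>Im s\<bar>) / 2) \<le> cos (\<delta> * Re s) * ((exp (\<delta> * Im s) + exp (- (\<delta> * Im s))) / 2)"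
      using cos_ge[OF that] exp_le[of "Im s"] by (intro mult_mono) auto
    then show ?thesis by (simp add: Re_cos_eq)
  qed
  obtain n where n: "p \<le> real n" using real_arch_simple by blast
  have *: "norm (f z) \<le> C * exp (\<epsilon> * Re (cos (of_real \<delta> * z)))" if "\<epsilon> > 0" for \<epsilon>
  proof -
    \<comment> \<open>The inequality wanted on the horizontal sides is rewritten in
      \<open>u = \<delta> * (1 + B + T)\<close> and divided by \<open>exp u\<close>;
      \<open>c\<close> is what then remains of the damping term.\<close>
    define c where "c = \<epsilon> / 4 * exp (- \<delta> * (1 + B))"
    have "c > 0" using that by (simp add: c_def)
    have "((\<lambda>u::real. \<bar>A\<bar> / \<delta> ^ n * (u ^ n / exp u) - ln C * (u ^ 0 / exp u)) \<longlongrightarrow> \<bar>A\<bar> / \<delta> ^ n * 0 - ln C * 0) at_top"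
      by (intro tendsto_intros tendsto_power_div_exp_0)
    then have "eventually (\<lambda>u. \<bar>A\<bar> / \<delta> ^ n * (u ^ n / exp u) - ln C * (u ^ 0 / exp u) < c) at_top"
      using \<open>c > 0\<close> by (intro order_tendstoD) auto
    with eventually_gt_at_top[of "\<delta> * (1 + B + \<bar>Im z\<bar>)"] obtain u
      where u: "\<delta> * (1 + B + \<bar>Im z\<bar>) < u" "\<bar>A\<bar> / \<delta> ^ n * (u ^ n / exp u) - ln C * (u ^ 0 / exp u) < c"
      using eventually_happens[OF eventually_conj] by (metis (mono_tags, lifting) trivial_limit_at_top_linorder)
    define T where "T = u / \<delta> - 1 - B"
    have uT: "u = \<delta> * (1 + B + T)" using \<open>\<delta> > 0\<close> by (simp add: T_def)
    have T: "\<bar>Im z\<bar> < T" using u(1) \<open>\<delta> > 0\<close> unfolding uT by simp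
    have T_bound: "\<bar>A\<bar> * (1 + B + T) ^ n - \<epsilon> / 4 * exp (\<delta> * T) \<le> ln C"
    proof -
      have "(\<bar>A\<bar> / \<delta> ^ n * (u ^ n / exp u) - ln C * (u ^ 0 / exp u)) * exp u \<le> c * exp u"
        using u(2) by (intro mult_right_mono) auto
      then have "\<bar>A\<bar> / \<delta> ^ n * u ^ n - ln C \<le> c * exp u"
        by (simp add: left_diff_distrib)
      moreover have "\<bar>A\<bar> / \<delta> ^ n * u ^ n = \<bar>A\<bar> * (1 + B + T) ^ n"
        using \<open>\<delta> > 0\<close> by (simp add: uT power_mult_distrib)
      moreover have "c * exp u = \<epsilon> / 4 * exp (\<delta> * T)"
        by (simp add: c_def uT exp_add[symmetric] algebra_simps)
      ultimately show ?thesis by linarith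
    qed
    define h where "h = (\<lambda>s. f s * exp (- of_real \<epsilon> * cos (of_real \<delta> * s)))"
    have norm_h: "norm (h s) = norm (f s) * exp (- \<epsilon> * Re (cos (of_real \<delta> * s)))" for s
      by (simp add: h_def norm_mult)
    let ?S = "cbox (Complex (- B) (- T)) (Complex B T)"
    have S_U: "?S \<subseteq> U" using U(2) by (force simp: in_cbox_complex_iff)
    have h_hol: "h holomorphic_on U"
      unfolding h_def by (intro holomorphic_intros f)
    have "norm (h z) \<le> C"
    proof (rule maximum_modulus_frontier[of h ?S])
      show "h holomorphic_on interior ?S"
        by (rule holomorphic_on_subset[OF h_hol]) (use S_U interior_subset in blast)
      show "continuous_on (closure ?S) h"
        by (rule holomorphic_on_imp_continuous_on[OF holomorphic_on_subset[OF h_hol]]) (use S_U in simp)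
      show "z \<in> ?S" using z T by (auto simp: in_cbox_complex_iff)
      fix s assume "s \<in> frontier ?S"
      then have s: "\<bar>Re s\<bar> \<le> B" "\<bar>Im s\<bar> \<le> T" "\<bar>Re s\<bar> = B \<or> \<bar>Im s\<bar> = T"
        by (auto simp: frontier_cbox in_cbox_complex_iff in_box_complex_iff)
      show "norm (h s) \<le> C"
      proof (cases "\<bar>Re s\<bar> = B")
        case True
        have "0 \<le> Re (cos (of_real \<delta> * s))"
          by (rule order_trans[OF _ Re_cos_ge[OF s(1)]]) simp
        then have "norm (f s) * exp (- \<epsilon> * Re (cos (of_real \<delta> * s))) \<le> C * 1"
          using side[OF True] \<open>\<epsilon> > 0\<close> \<open>C > 0\<close> by (intro mult_mono) auto
        then show ?thesis by (simp add: norm_h)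
      next
        case False
        then have "\<bar>Im s\<bar> = T" using s by blast
        have "1 + norm s \<le> 1 + B + T"
          using cmod_le[of s] s by simp
        have "(1 + norm s) powr p \<le> (1 + norm s) powr real n"
          using n by (intro powr_mono) auto
        also have "\<dots> = (1 + norm s) ^ n" by (simp add: powr_realpow add_pos_nonneg)
        also have "\<dots> \<le> (1 + B + T) ^ n"
          using \<open>1 + norm s \<le> 1 + B + T\<close> by (intro power_mono) auto
        finally have "A * (1 + norm s) powr p \<le> \<bar>A\<bar> * (1 + B + T) ^ n"
          by (intro mult_mono) auto
        moreover have "\<epsilon> * (exp (\<delta> * T) / 4) \<le> \<epsilon> * Re (cos (of_real \<delta> * s))"
          using Re_cos_ge[OF s(1)] \<open>\<epsilon> > 0\<close> unfolding \<open>\<bar>Im s\<bar> = T\<close> by (intro mult_left_mono) auto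
        ultimately have le: "A * (1 + norm s) powr p + (- \<epsilon> * Re (cos (of_real \<delta> * s))) \<le> ln C"
          using T_bound by simp
        have "norm (h s) \<le> exp (A * (1 + norm s) powr p) * exp (- \<epsilon> * Re (cos (of_real \<delta> * s)))"
          unfolding norm_h by (intro mult_right_mono growth s) auto
        also have "\<dots> = exp (A * (1 + norm s) powr p + (- \<epsilon> * Re (cos (of_real \<delta> * s))))"
          by (rule exp_add[symmetric])
        also have "\<dots> \<le> exp (ln C)" using le by (simp only: exp_le_cancel_iff)
        finally show ?thesis using \<open>C > 0\<close> by simp
      qed
    qed simp
    then have "norm (f z) * exp (- \<epsilon> * Re (cos (of_real \<delta> * z))) * exp (\<epsilon> * Re (cos (of_real \<delta> * z)))
        \<le> C * exp (\<epsilon> * Re (cos (of_real \<delta> * z)))"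
      unfolding norm_h by (intro mult_right_mono) auto
    then show ?thesis by (simp add: mult.assoc exp_add[symmetric])
  qed
  have "((\<lambda>\<epsilon>. C * exp (\<epsilon> * Re (cos (of_real \<delta> * z)))) \<longlongrightarrow> C * exp (0 * Re (cos (of_real \<delta> * z)))) (at_right 0)"
    by (intro tendsto_intros)
  then have "((\<lambda>\<epsilon>. C * exp (\<epsilon> * Re (cos (of_real \<delta> * z)))) \<longlongrightarrow> C) (at_right 0)" by simp
  then show ?thesis
    by (rule tendsto_lowerbound) (auto simp: eventually_at_right_less * intro!: eventually_mono[OF eventually_at_right_less[of 0]])
qed

subsection \<open>Growth of order \<open>p\<close>\<close>

text \<open>Order at most \<open>p\<close>, relative to a region. For \<open>p \<ge> 0\<close> a
  constant factor needs no place of its own: \<open>(1 + norm s) powr p \<ge> 1\<close> lets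
  \<open>A\<close> absorb it.\<close>

definition exp_growth :: "complex set \<Rightarrow> real \<Rightarrow> (complex \<Rightarrow> complex) \<Rightarrow> bool" where
  "exp_growth U p f \<longleftrightarrow> (\<exists>A. \<forall>s\<in>U. norm (f s) \<le> exp (A * (1 + norm s) powr p))"

lemma exp_growthI: "(\<And>s. s \<in> U \<Longrightarrow> norm (f s) \<le> exp (A * (1 + norm s) powr p)) \<Longrightarrow> exp_growth U p f"
  unfolding exp_growth_def by blast

lemma exp_growthE:
  assumes "exp_growth U p f"
  obtains A where "A \<ge> 0" "\<And>s. s \<in> U \<Longrightarrow> norm (f s) \<le> exp (A * (1 + norm s) powr p)"
proof -
  obtain A where A: "\<And>s. s \<in> U \<Longrightarrow> norm (f s) \<le> exp (A * (1 + norm s) powr p)"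
    using assms by (auto simp: exp_growth_def)
  have "norm (f s) \<le> exp (\<bar>A\<bar> * (1 + norm s) powr p)" if "s \<in> U" for s
    by (rule order_trans[OF A[OF that]]) (simp add: mult_right_mono)
  then show ?thesis using that[of "\<bar>A\<bar>"] by simp
qed

lemma exp_growth_mono:
  assumes "exp_growth V p f" "U \<subseteq> V" "p \<le> q"
  shows "exp_growth U q f"
proof -
  obtain A where A: "A \<ge> 0" "\<And>s. s \<in> V \<Longrightarrow> norm (f s) \<le> exp (A * (1 + norm s) powr p)"
    using exp_growthE[OF assms(1)] by blast
  have "norm (f s) \<le> exp (A * (1 + norm s) powr q)" if "s \<in> U" for s
  proof -
    have "A * (1 + norm s) powr p \<le> A * (1 + norm s) powr q"
      using A(1) assms(3) by (intro mult_left_mono powr_mono) auto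
    then show ?thesis using A(2)[of s] assms(2) that by (meson exp_le_cancel_iff order_trans subsetD)
  qed
  then show ?thesis by (rule exp_growthI)
qed

lemma exp_growth_cong: "(\<And>s. s \<in> U \<Longrightarrow> norm (f s) = norm (g s)) \<Longrightarrow> exp_growth U p f \<longleftrightarrow> exp_growth U p g"
  by (simp add: exp_growth_def)

lemma exp_growth_Un:
  assumes "exp_growth U p f" "exp_growth V p f"
  shows "exp_growth (U \<union> V) p f"
proof -
  obtain A where A: "A \<ge> 0" "\<And>s. s \<in> U \<Longrightarrow> norm (f s) \<le> exp (A * (1 + norm s) powr p)"
    using exp_growthE[OF assms(1)] by blast
  obtain B where B: "B \<ge> 0" "\<And>s. s \<in> V \<Longrightarrow> norm (f s) \<le> exp (B * (1 + norm s) powr p)"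
    using exp_growthE[OF assms(2)] by blast
  have le: "exp (A * (1 + norm s) powr p) \<le> exp (max A B * (1 + norm s) powr p)"
    "exp (B * (1 + norm s) powr p) \<le> exp (max A B * (1 + norm s) powr p)" for s :: complex
    by (simp_all add: mult_right_mono)
  show ?thesis
  proof (rule exp_growthI)
    fix s assume "s \<in> U \<union> V"
    then show "norm (f s) \<le> exp (max A B * (1 + norm s) powr p)"
      using order_trans[OF A(2)[of s] le(1)] order_trans[OF B(2)[of s] le(2)] by blast
  qed
qed

lemma exp_growth_mult:
  assumes "exp_growth U p f" "exp_growth U p g"
  shows "exp_growth U p (\<lambda>s. f s * g s)"
proof -
  obtain A where A: "A \<ge> 0" "\<And>s. s \<in> U \<Longrightarrow> norm (f s) \<le> exp (A * (1 + norm s) powr p)"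
    using exp_growthE[OF assms(1)] by blast
  obtain B where B: "B \<ge> 0" "\<And>s. s \<in> U \<Longrightarrow> norm (g s) \<le> exp (B * (1 + norm s) powr p)"
    using exp_growthE[OF assms(2)] by blast
  show ?thesis
  proof (rule exp_growthI)
    fix s assume "s \<in> U"
    have "norm (f s * g s) \<le> exp (A * (1 + norm s) powr p) * exp (B * (1 + norm s) powr p)"
      unfolding norm_mult by (intro mult_mono A B \<open>s \<in> U\<close>) auto
    then show "norm (f s * g s) \<le> exp ((A + B) * (1 + norm s) powr p)"
      by (simp add: exp_add distrib_right)
  qed
qed

lemma exp_growth_bounded:
  assumes "p \<ge> 0" "\<And>s. s \<in> U \<Longrightarrow> norm (f s) \<le> C"
  shows "exp_growth U p f"
proof (rule exp_growthI)
  fix s assume "s \<in> U"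
  have "1 \<le> (1 + norm s) powr p" using assms(1) by (intro ge_one_powr_ge_zero) auto
  then have "\<bar>C\<bar> * 1 \<le> \<bar>C\<bar> * (1 + norm s) powr p" by (intro mult_left_mono) auto
  moreover have "norm (f s) \<le> \<bar>C\<bar>" using assms(2)[OF \<open>s \<in> U\<close>] by linarith
  moreover have "\<bar>C\<bar> \<le> exp \<bar>C\<bar>" using exp_ge_add_one_self[of "\<bar>C\<bar>"] by linarith
  ultimately show "norm (f s) \<le> exp (\<bar>C\<bar> * (1 + norm s) powr p)"
    by (smt (verit) exp_le_cancel_iff)
qed

lemma exp_growth_prod:
  assumes "p \<ge> 0" "finite I" "\<And>i. i \<in> I \<Longrightarrow> exp_growth U p (f i)"
  shows "exp_growth U p (\<lambda>s. \<Prod>i\<in>I. f i s)"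
  using assms(2,3)
proof (induction I rule: finite_induct)
  case empty
  show ?case by (rule exp_growth_bounded[OF \<open>p \<ge> 0\<close>, of _ _ 1]) simp
next
  case (insert i I)
  then show ?case by (simp add: exp_growth_mult)
qed

lemma exp_growth_power:
  assumes "p \<ge> 0" "exp_growth U p f"
  shows "exp_growth U p (\<lambda>s. f s ^ n)"
  using exp_growth_prod[of p "{..<n}" U "\<lambda>_. f"] assms by simp

lemma le_powr_ge_1: "1 \<le> x \<Longrightarrow> 1 \<le> p \<Longrightarrow> x \<le> x powr (p :: real)"
  using powr_mono[of 1 p x] by simp

lemma exp_growth_linear:
  assumes "p \<ge> 1" "\<And>s. s \<in> U \<Longrightarrow> norm (f s) \<le> exp (A * (1 + norm s))"
  shows "exp_growth U p f"
proof (rule exp_growthI)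
  fix s assume "s \<in> U"
  have "A * (1 + norm s) \<le> \<bar>A\<bar> * (1 + norm s) powr p"
    using assms(1) by (intro mult_mono le_powr_ge_1) auto
  then show "norm (f s) \<le> exp (\<bar>A\<bar> * (1 + norm s) powr p)"
    using assms(2)[OF \<open>s \<in> U\<close>] by (meson exp_le_cancel_iff order_trans)
qed

lemma exp_growth_diff_const:
  assumes "p \<ge> 1"
  shows "exp_growth U p (\<lambda>s. s - a)"
proof (rule exp_growth_linear[OF assms])
  fix s
  have "norm (s - a) \<le> norm s + norm a" by (rule norm_triangle_ineq4)
  also have "\<dots> \<le> (1 + norm a) * (1 + norm s)" by (simp add: algebra_simps)
  also have "\<dots> \<le> exp ((1 + norm a) * (1 + norm s))"
    using exp_ge_add_one_self[of "(1 + norm a) * (1 + norm s)"] by linarith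
  finally show "norm (s - a) \<le> exp ((1 + norm a) * (1 + norm s))" .
qed

lemma exp_growth_powr:
  assumes "p \<ge> 1" "Q > 0"
  shows "exp_growth U p (\<lambda>s. of_real Q powr s)"
proof (rule exp_growth_linear[OF assms(1)])
  fix s
  have "norm (of_real Q powr s) = exp (ln Q * Re s)"
    using \<open>Q > 0\<close> by (simp add: norm_powr_real_powr powr_def mult.commute)
  also have "ln Q * Re s \<le> \<bar>ln Q\<bar> * (1 + norm s)"
    using abs_Re_le_cmod[of s] abs_le_D1[of "ln Q * Re s" "\<bar>ln Q\<bar> * (1 + norm s)"]
    by (simp add: abs_mult mult_left_mono)
  finally show "norm (of_real Q powr s) \<le> exp (\<bar>ln Q\<bar> * (1 + norm s))" by simp
qed

lemma exp_growth_compose: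
  assumes "exp_growth V p f" "p \<ge> 0" "K > 0"
    and g: "\<And>s. s \<in> U \<Longrightarrow> g s \<in> V" "\<And>s. s \<in> U \<Longrightarrow> 1 + norm (g s) \<le> K * (1 + norm s)"
  shows "exp_growth U p (\<lambda>s. f (g s))"
proof -
  obtain A where A: "A \<ge> 0" "\<And>s. s \<in> V \<Longrightarrow> norm (f s) \<le> exp (A * (1 + norm s) powr p)"
    using exp_growthE[OF assms(1)] by blast
  show ?thesis
  proof (rule exp_growthI)
    fix s assume s: "s \<in> U"
    have "(1 + norm (g s)) powr p \<le> (K * (1 + norm s)) powr p"
      using g(2)[OF s] \<open>p \<ge> 0\<close> by (intro powr_mono2) auto
    also have "\<dots> = K powr p * (1 + norm s) powr p"
      using \<open>K > 0\<close> by (intro powr_mult)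
    finally have "A * (1 + norm (g s)) powr p \<le> A * (K powr p * (1 + norm s) powr p)"
      using A(1) by (intro mult_left_mono) auto
    then show "norm (f (g s)) \<le> exp (A * K powr p * (1 + norm s) powr p)"
      using A(2)[OF g(1)[OF s]] by (smt (verit) exp_le_cancel_iff mult.assoc)
  qed
qed

lemma finite_order_imp_exp_growth:
  assumes "G holomorphic_on UNIV" "finite_order G"
  obtains p where "exp_growth UNIV p G" "p \<ge> 0"
proof -
  obtain \<rho> C where \<rho>: "\<And>s. norm (G s) \<le> C * exp (norm s powr \<rho>)"
    using assms(2) by (auto simp: finite_order_def)
  \<comment> \<open>A negative \<open>\<rho>\<close> is permitted by \<open>finite_order\<close>.
    The given bound may then blow up near 0, so the unit disc is treated by compactness
    instead.\<close>
  define p where "p = max \<rho> 0"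
  have "compact (G ` cball 0 1)"
    by (intro compact_continuous_image holomorphic_on_imp_continuous_on holomorphic_on_subset[OF assms(1)]) auto
  then obtain B where B: "\<And>s. s \<in> cball 0 1 \<Longrightarrow> norm (G s) \<le> B"
    using compact_imp_bounded by (force simp: bounded_iff)
  have "exp_growth (cball 0 1) p G"
    by (rule exp_growth_bounded[OF _ B]) (auto simp: p_def)
  moreover have "exp_growth (- cball 0 1) p G"
  proof (rule exp_growthI)
    fix s :: complex assume "s \<in> - cball 0 1"
    then have s: "norm s > 1" by simp
    have "norm s powr \<rho> \<le> norm s powr p" using s by (intro powr_mono) (auto simp: p_def)
    also have "\<dots> \<le> (1 + norm s) powr p" by (intro powr_mono2) (auto simp: p_def)
    finally have 1: "norm s powr \<rho> \<le> (1 + norm s) powr p" .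
    have "1 \<le> (1 + norm s) powr p" by (intro ge_one_powr_ge_zero) (auto simp: p_def)
    then have 2: "\<bar>C\<bar> * 1 \<le> \<bar>C\<bar> * (1 + norm s) powr p" by (intro mult_left_mono) auto
    have "C \<le> exp \<bar>C\<bar>" using exp_ge_add_one_self[of "\<bar>C\<bar>"] by linarith
    then have "norm (G s) \<le> exp \<bar>C\<bar> * exp (norm s powr \<rho>)"
      by (intro order_trans[OF \<rho>] mult_right_mono) auto
    also have "\<dots> = exp (\<bar>C\<bar> + norm s powr \<rho>)" by (rule exp_add[symmetric])
    also have "\<dots> \<le> exp ((\<bar>C\<bar> + 1) * (1 + norm s) powr p)"
      using 1 2 by (simp add: distrib_right)
    finally show "norm (G s) \<le> exp ((\<bar>C\<bar> + 1) * (1 + norm s) powr p)" .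
  qed
  ultimately have "exp_growth (cball 0 1 \<union> - cball 0 1) p G" by (rule exp_growth_Un)
  then show ?thesis using that[of p] by (simp add: p_def)
qed

text \<open>Absolute values inside Euler's integral. This reduces growth in half-planes, and
  boundedness on vertical lines, to the positive axis.\<close>

lemma norm_Gamma_le:
  assumes "Re z > 0"
  shows "norm (Gamma z) \<le> Gamma (Re z)"
proof -
  have 1: "((\<lambda>t. of_real t powr (z - 1) / of_real (exp t)) has_integral Gamma z) {0..}"
    by (rule Gamma_integral_complex[OF assms])
  have 2: "((\<lambda>t. t powr (Re z - 1) / exp t) has_integral Gamma (Re z)) {0..}"
    by (rule Gamma_integral_real[OF assms])
  have "norm (integral {0..} (\<lambda>t. of_real t powr (z - 1) / of_real (exp t) :: complex))
     \<le> integral {0..} (\<lambda>t. t powr (Re z - 1) / exp t)"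
  proof (rule integral_norm_bound_integral)
    fix t :: real assume "t \<in> {0..}"
    then show "norm (of_real t powr (z - 1) / of_real (exp t) :: complex) \<le> t powr (Re z - 1) / exp t"
      by (cases "t = 0") (auto simp: norm_divide norm_powr_real_powr)
  qed (use 1 2 in \<open>auto simp: has_integral_integrable\<close>)
  then show ?thesis
    using 1 2 by (simp add: integral_unique)
qed

text \<open>Iterating \<open>Gamma x = (x - 1) * Gamma (x - 1)\<close> down to a compact interval
  gives \<open>B' * (1 + x) ^ n\<close> with \<open>n\<close> near \<open>x\<close>. The resulting
  \<open>x * ln x\<close> in the exponent is majorized through \<open>ln y \<le> 2 * sqrt y\<close>,
  which is the source of 3/2.\<close>

lemma Gamma_real_growth:
  assumes "x0 > (0::real)"
  obtains A where "A \<ge> 0" "\<And>x. x \<ge> x0 \<Longrightarrow> Gamma x \<le> exp (A * (1 + x) powr (3 / 2))"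
proof -
  have "continuous_on {x0..x0 + 1} (Gamma :: real \<Rightarrow> real)"
    using assms by (intro continuous_on_Gamma continuous_on_id) (auto elim!: nonpos_Ints_cases)
  then have "compact ((Gamma :: real \<Rightarrow> real) ` {x0..x0 + 1})"
    by (rule compact_continuous_image) auto
  then obtain B where B: "\<And>x. x \<in> {x0..x0 + 1} \<Longrightarrow> \<bar>Gamma x\<bar> \<le> B"
    using compact_imp_bounded by (force simp: bounded_iff)
  define B' where "B' = max B 1"
  have bound: "Gamma x \<le> B' * (1 + x) ^ n" if "x0 \<le> x" "x \<le> x0 + 1 + real n" for x n
    using that
  proof (induction n arbitrary: x)
    case 0
    then show ?case using B[of x] by (simp add: B'_def)
  next
    case (Suc n)
    show ?case
    proof (cases "x \<le> x0 + 1")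
      case True
      then have "Gamma x \<le> B' * 1" using B[of x] Suc by (simp add: B'_def)
      also have "\<dots> \<le> B' * (1 + x) ^ Suc n"
        using assms Suc.prems by (intro mult_left_mono one_le_power) (auto simp: B'_def)
      finally show ?thesis .
    next
      case False
      have "Gamma (x - 1) \<le> B' * (1 + (x - 1)) ^ n"
        using False Suc.prems by (intro Suc.IH) auto
      also have "\<dots> \<le> B' * (1 + x) ^ n"
        using assms Suc.prems by (intro mult_left_mono power_mono) (auto simp: B'_def)
      finally have "(x - 1) * Gamma (x - 1) \<le> (1 + x) * (B' * (1 + x) ^ n)"
        using False assms Gamma_real_pos[of "x - 1"] by (intro mult_mono) (auto simp: B'_def less_imp_le)
      moreover have "Gamma x = (x - 1) * Gamma (x - 1)"
        using Gamma_plus1[of "x - 1"] nonpos_Ints_nonpos[of "x - 1"] False assms by force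
      ultimately show ?thesis by (simp add: mult_ac)
    qed
  qed
  show ?thesis
  proof (rule that[of "ln B' + 2"])
    show "0 \<le> ln B' + 2" by (simp add: B'_def)
    fix x assume x: "x0 \<le> x"
    define n where "n = nat \<lceil>x\<rceil>"
    have n: "x \<le> real n" "real n \<le> 1 + x" using x assms unfolding n_def by linarith+
    have y: "1 + x \<ge> 1" using x assms by simp
    have p: "(1 + x) powr (3 / 2) = (1 + x) * sqrt (1 + x)"
      using powr_add[of "1 + x" 1 "1 / 2"] y by (simp add: powr_half_sqrt)
    have "ln (1 + x) \<le> 2 * sqrt (1 + x)"
      using ln_le_minus_one[of "sqrt (1 + x)"] y by (simp add: ln_sqrt)
    then have "real n * ln (1 + x) \<le> (1 + x) * (2 * sqrt (1 + x))"
      using n y by (intro mult_mono) auto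
    then have e: "real n * ln (1 + x) \<le> 2 * (1 + x) powr (3 / 2)" by (simp add: p)
    have "ln B' * 1 \<le> ln B' * (1 + x) powr (3 / 2)"
      using y by (intro mult_left_mono ge_one_powr_ge_zero) (auto simp: B'_def)
    then have "ln B' + real n * ln (1 + x) \<le> (ln B' + 2) * (1 + x) powr (3 / 2)"
      using e by (simp add: distrib_right)
    moreover have "B' * (1 + x) ^ n = exp (ln B' + real n * ln (1 + x))"
      using y by (simp add: exp_add B'_def exp_of_nat_mult)
    moreover have "Gamma x \<le> B' * (1 + x) ^ n" using x n assms by (intro bound) auto
    ultimately show "Gamma x \<le> exp ((ln B' + 2) * (1 + x) powr (3 / 2))"
      by (metis exp_le_cancel_iff order_trans)
  qed
qed

lemma exp_growth_Gamma:
  assumes "l > 0" "Re \<mu> \<ge> 0" "c > 0" "p \<ge> 3 / 2"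
  shows "exp_growth {s. Re s \<ge> c} p (\<lambda>s. Gamma (of_real l * s + \<mu>))"
proof -
  obtain A where A: "A \<ge> 0" "\<And>x. x \<ge> l * c \<Longrightarrow> Gamma x \<le> exp (A * (1 + x) powr (3 / 2))"
    using Gamma_real_growth[of "l * c"] assms by auto
  have "exp_growth {s. Re s \<ge> l * c} (3 / 2) Gamma"
  proof (rule exp_growthI)
    fix s assume "s \<in> {s. Re s \<ge> l * c}"
    then have s: "Re s \<ge> l * c" "l * c > 0" using assms by auto
    have "norm (Gamma s) \<le> Gamma (Re s)" using s by (intro norm_Gamma_le) auto
    also have "\<dots> \<le> exp (A * (1 + Re s) powr (3 / 2))" by (rule A(2)[OF s(1)])
    also have "\<dots> \<le> exp (A * (1 + norm s) powr (3 / 2))"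
      using complex_Re_le_cmod[of s] A(1) s by (simp add: mult_left_mono powr_mono2)
    finally show "norm (Gamma s) \<le> exp (A * (1 + norm s) powr (3 / 2))" .
  qed
  then have "exp_growth {s. Re s \<ge> c} (3 / 2) (\<lambda>s. Gamma (of_real l * s + \<mu>))"
  proof (rule exp_growth_compose)
    show "1 + l + norm \<mu> > 0" using assms by (simp add: add_pos_nonneg)
    fix s assume "s \<in> {s. Re s \<ge> c}"
    then show "of_real l * s + \<mu> \<in> {s. Re s \<ge> l * c}"
      using assms by (auto simp: add_increasing2)
    have "norm (of_real l * s + \<mu>) \<le> l * norm s + norm \<mu>"
      using norm_triangle_ineq[of "of_real l * s" \<mu>] assms by (simp add: norm_mult)
    moreover have "(1 + l + norm \<mu>) * (1 + norm s) = 1 + l * norm s + norm \<mu> + (l + norm s + norm \<mu> * norm s)"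
      by (simp add: algebra_simps)
    moreover have "0 \<le> l + norm s + norm \<mu> * norm s" using assms by simp
    ultimately show "1 + norm (of_real l * s + \<mu>) \<le> (1 + l + norm \<mu>) * (1 + norm s)"
      by linarith
  qed simp
  then show ?thesis by (rule exp_growth_mono) (use assms in auto)
qed

subsection \<open>The completed L-function\<close>

text \<open>
  In the application \<open>P s = s\<^sup>k Q\<^sup>s (\<Prod>j. Gamma (\<lambda>\<^sub>j s + \<mu>\<^sub>j))\<close>, where \<open>k\<close> is the order of
  the pole of \<open>F\<close> at \<open>1\<close>.
\<close>
locale completed_L_function =
  fixes \<xi> P G F :: "complex \<Rightarrow> complex" and \<omega> :: complex and p :: real and k :: nat and C C' :: real
  assumes p: "1 \<le> p" "p < 2"
    and P_holomorphic: "P holomorphic_on {s. Re s > 0}"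
    and P_nonzero: "Re s > 0 \<Longrightarrow> P s \<noteq> 0"
    and P_growth: "exp_growth {s. Re s \<ge> 1 / 2} p P"
    and P_line: "Re s = 2 \<Longrightarrow> norm (P s) \<le> C * (1 + norm s) ^ k"
    and G_holomorphic: "G holomorphic_on UNIV"
    and G_finite_order: "finite_order G"
    and G_eq: "s \<noteq> 1 \<Longrightarrow> G s = (s - 1) ^ k * F s"
    and G_1: "G 1 \<noteq> 0"
    and F_bounded: "Re s \<ge> 2 \<Longrightarrow> norm (F s) \<le> C'"
    and F_nonzero: "Re s > 1 \<Longrightarrow> F s \<noteq> 0"
    and xi_eq: "Re s > 0 \<Longrightarrow> \<xi> s = P s * G s"
    and functional_equation: "\<xi> s = \<omega> * cnj (\<xi> (1 - cnj s))"
    and norm_omega: "norm \<omega> = 1"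
begin

lemma norm_xi_reflect: "norm (\<xi> s) = norm (\<xi> (1 - cnj s))"
  by (subst functional_equation) (simp add: norm_mult norm_omega)

text \<open>Right of the imaginary axis \<open>\<xi>\<close> is \<open>P * G\<close>. Elsewhere the
  functional equation writes it as its own reflection with two conjugations, which together preserve
  complex differentiability.\<close>

lemma xi_holomorphic: "\<xi> holomorphic_on UNIV"
proof -
  have right: "\<xi> holomorphic_on {s. Re s > 0}"
    by (rule holomorphic_transform[where f = "\<lambda>s. P s * G s"])
       (auto intro!: holomorphic_intros P_holomorphic holomorphic_on_subset[OF G_holomorphic] simp: xi_eq)
  have "\<xi> field_differentiable at s" for s
  proof (cases "Re s > 0")
    case True
    then show ?thesis
      using right by (auto simp: holomorphic_on_open open_halfspace_Re_gt field_differentiable_def)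
  next
    case False
    then have "Re (1 - cnj s) > 0" by simp
    then have "\<xi> field_differentiable at (1 - cnj s)"
      using right by (auto simp: holomorphic_on_open open_halfspace_Re_gt field_differentiable_def)
    then obtain D where D: "(\<xi> has_field_derivative D) (at (1 - cnj s))" by (auto simp: field_differentiable_def)
    have "((\<lambda>t. 1 - t) has_field_derivative - 1) (at (cnj s))"
      by (auto intro!: derivative_eq_intros)
    from DERIV_chain2[OF D this]
    have "((\<lambda>t. \<xi> (1 - t)) has_field_derivative - D) (at (cnj s))" by simp
    then have "((cnj \<circ> (\<lambda>t. \<xi> (1 - t)) \<circ> cnj) has_field_derivative cnj (- D)) (at s)"
      by (metis complex_cnj_cnj has_field_derivative_cnj_cnj)
    then have "((\<lambda>t. \<omega> * (cnj \<circ> (\<lambda>t. \<xi> (1 - t)) \<circ> cnj) t) has_field_derivative \<omega> * cnj (- D)) (at s)"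
      by (rule DERIV_cmult)
    moreover have "(\<lambda>t. \<omega> * (cnj \<circ> (\<lambda>t. \<xi> (1 - t)) \<circ> cnj) t) = \<xi>"
      by (rule ext) (simp add: functional_equation[symmetric])
    ultimately show ?thesis by (auto simp: field_differentiable_def)
  qed
  then show ?thesis by (simp add: holomorphic_on_def)
qed

lemma xi_nonzero_right: "Re s > 1 \<Longrightarrow> \<xi> s \<noteq> 0"
  using xi_eq[of s] P_nonzero[of s] G_eq[of s] F_nonzero[of s] by (cases "s = 1") auto

lemma xi_1: "\<xi> 1 \<noteq> 0"
  using xi_eq[of 1] P_nonzero[of 1] G_1 by simp

lemma xi_zero_if_F_zero: "Re s > 0 \<Longrightarrow> s \<noteq> 1 \<Longrightarrow> F s = 0 \<Longrightarrow> \<xi> s = 0"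
  by (simp add: xi_eq G_eq)

lemma exp_growth_reflect:
  assumes "exp_growth U q \<xi>" "q \<ge> 0"
  shows "exp_growth {s. 1 - cnj s \<in> U} q \<xi>"
proof -
  have *: "exp_growth {s. 1 - cnj s \<in> U} q (\<lambda>s. \<xi> (1 - cnj s))"
  proof (rule exp_growth_compose[OF assms])
    fix s :: complex
    show "1 + norm (1 - cnj s) \<le> 2 * (1 + norm s)"
      using norm_triangle_ineq4[of 1 "cnj s"] norm_ge_zero[of s] by (simp del: norm_ge_zero)
  qed auto
  show ?thesis
    by (rule exp_growth_cong[THEN iffD2, OF _ *]) (rule norm_xi_reflect)
qed

text \<open>The half-plane \<open>Re s \<ge> 1 / 2\<close> and its reflection cover the plane. The
  exponent \<open>q\<close> is uncontrolled, as it depends on the order of \<open>G\<close>;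
  Phragmen-Lindeloef accepts any.\<close>

lemma xi_growth_crude: obtains q where "q \<ge> 0" "exp_growth UNIV q \<xi>"
proof -
  obtain q where q: "exp_growth UNIV q G" "q \<ge> 0"
    using finite_order_imp_exp_growth[OF G_holomorphic G_finite_order] by blast
  define q' where "q' = max p q"
  have "exp_growth {s. Re s \<ge> 1 / 2} q' (\<lambda>s. P s * G s)"
    by (intro exp_growth_mult exp_growth_mono[OF P_growth] exp_growth_mono[OF q(1)]) (auto simp: q'_def)
  then have right: "exp_growth {s. Re s \<ge> 1 / 2} q' \<xi>"
    by (subst exp_growth_cong[where g = "\<lambda>s. P s * G s"]) (auto simp: xi_eq)
  have "q' \<ge> 0" using p by (simp add: q'_def)
  have "{s. Re s \<ge> 1 / 2} \<union> {s. 1 - cnj s \<in> {s. Re s \<ge> 1 / 2}} = UNIV" by auto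
  then show ?thesis
    using that[OF \<open>q' \<ge> 0\<close>] exp_growth_Un[OF right exp_growth_reflect[OF right \<open>q' \<ge> 0\<close>]] by simp
qed

text \<open>One power \<open>k\<close> comes from the bound for \<open>P\<close>, the other from the
  factor \<open>(s - 1) ^ k\<close> in \<open>G\<close>.\<close>

lemma xi_line_bound:
  assumes "Re s = 2"
  shows "norm (\<xi> s) \<le> \<bar>C\<bar> * \<bar>C'\<bar> * ((1 + norm s) ^ k) ^ 2"
proof -
  have "norm (s - 1) \<le> 1 + norm s" using norm_triangle_ineq4[of s 1] by simp
  then have 1: "norm (s - 1) ^ k \<le> (1 + norm s) ^ k" by (rule power_mono) simp
  have 2: "norm (P s) \<le> \<bar>C\<bar> * (1 + norm s) ^ k"
    by (rule order_trans[OF P_line[OF assms]]) (simp add: mult_right_mono)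
  have 3: "norm (F s) \<le> \<bar>C'\<bar>" using F_bounded[of s] assms by simp
  have "s \<noteq> 1" using assms by auto
  then have "norm (\<xi> s) = norm (P s) * (norm (s - 1) ^ k * norm (F s))"
    using assms by (simp add: xi_eq G_eq norm_mult norm_power)
  also have "\<dots> \<le> (\<bar>C\<bar> * (1 + norm s) ^ k) * ((1 + norm s) ^ k * \<bar>C'\<bar>)"
    by (intro mult_mono 1 2 3) auto
  finally show ?thesis by (simp add: power2_eq_square mult_ac)
qed

text \<open>With \<open>s = 1 / 2 + w\<close> the reflection is \<open>w\<close> to
  \<open>- cnj w\<close>, so the line \<open>Re s = 2\<close> controls both edges. Division by
  \<open>((w + 5) ^ k) ^ 2\<close>, which has no zero in the strip, turns the polynomial bound on
  the edges into the constant one that Phragmen-Lindeloef needs.\<close>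

lemma xi_strip_bound:
  assumes w: "\<bar>Re w\<bar> \<le> 3 / 2"
  shows "norm (\<xi> (1 / 2 + w)) \<le> (\<bar>C\<bar> * \<bar>C'\<bar> * ((2 ^ k)\<^sup>2) + 1) * (norm (w + 5) ^ k) ^ 2"
proof -
  obtain q where q: "q \<ge> 0" "exp_growth UNIV q \<xi>" using xi_growth_crude by blast
  \<comment> \<open>The summand 1 keeps \<open>D\<close> positive even if \<open>C\<close> or
    \<open>C'\<close> is 0.\<close>
  define D where "D = \<bar>C\<bar> * \<bar>C'\<bar> * ((2 ^ k)\<^sup>2) + 1"
  have "D > 0" by (simp add: D_def add_nonneg_pos)
  define f where "f = (\<lambda>w. \<xi> (1 / 2 + w) / ((w + 5) ^ k) ^ 2)"
  have norm_5: "7 / 2 \<le> norm (w + 5)" "norm (Complex 2 (Im w)) + 1 \<le> 2 * norm (w + 5)" if "\<bar>Re w\<bar> \<le> 3 / 2" for w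
  proof -
    show "7 / 2 \<le> norm (w + 5)" using that complex_Re_le_cmod[of "w + 5"] by simp
    moreover have "\<bar>Im w\<bar> \<le> norm (w + 5)" using abs_Im_le_cmod[of "w + 5"] by simp
    moreover have "norm (Complex 2 (Im w)) \<le> 2 + \<bar>Im w\<bar>" using cmod_le[of "Complex 2 (Im w)"] by simp
    ultimately show "norm (Complex 2 (Im w)) + 1 \<le> 2 * norm (w + 5)" by linarith
  qed
  have "exp_growth UNIV q (\<lambda>w. \<xi> (1 / 2 + w))"
  proof (rule exp_growth_compose[OF q(2,1)])
    fix s :: complex
    show "1 + norm (1 / 2 + s) \<le> 2 * (1 + norm s)"
      using norm_triangle_ineq[of "1 / 2" s] norm_ge_zero[of s] by (simp del: norm_ge_zero)
  qed auto
  then obtain A where "A \<ge> 0" and A: "\<And>w. w \<in> UNIV \<Longrightarrow> norm (\<xi> (1 / 2 + w)) \<le> exp (A * (1 + norm w) powr q)"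
    by (rule exp_growthE) blast
  have norm_f: "norm (f w) = norm (\<xi> (1 / 2 + w)) / (norm (w + 5) ^ k) ^ 2" for w
    by (simp add: f_def norm_divide norm_power)
  have pos: "0 < (norm (w + 5) ^ k) ^ 2" if "\<bar>Re w\<bar> \<le> 3 / 2" for w
    using norm_5(1)[OF that] by (intro zero_less_power) linarith
  have "norm (f w) \<le> D"
  proof (rule phragmen_lindelof_strip[where f = f and z = w and B = "3 / 2" and U = "- {-5}" and A = A and p = q])
    have "(\<xi> \<circ> (\<lambda>w. 1 / 2 + w)) holomorphic_on - {-5}"
      by (rule holomorphic_on_compose_gen[OF _ xi_holomorphic]) (auto intro!: holomorphic_intros)
    then have "(\<lambda>w. \<xi> (1 / 2 + w)) holomorphic_on - {-5}" by (simp add: o_def)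
    then show "f holomorphic_on - {-5}"
      unfolding f_def by (intro holomorphic_intros) (auto simp: eq_neg_iff_add_eq_0)
    show "{s. \<bar>Re s\<bar> \<le> 3 / 2} \<subseteq> - {-5}" by auto
  next
    fix s :: complex assume s: "\<bar>Re s\<bar> = 3 / 2"
    have "norm (\<xi> (1 / 2 + s)) = norm (\<xi> (Complex 2 (Im s)))"
    proof (cases "Re s = 3 / 2")
      case True
      then have "1 / 2 + s = Complex 2 (Im s)" by (simp add: complex_eq_iff)
      then show ?thesis by (simp only:)
    next
      case False
      then have "1 - cnj (1 / 2 + s) = Complex 2 (Im s)" using s by (auto simp: complex_eq_iff)
      then show ?thesis using norm_xi_reflect[of "1 / 2 + s"] by (simp only:)
    qed
    also have "\<dots> \<le> \<bar>C\<bar> * \<bar>C'\<bar> * ((1 + norm (Complex 2 (Im s))) ^ k) ^ 2"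
      by (rule xi_line_bound) simp
    also have "\<dots> \<le> \<bar>C\<bar> * \<bar>C'\<bar> * ((2 * norm (s + 5)) ^ k) ^ 2"
      using norm_5(2)[of s] s by (intro mult_left_mono power_mono) auto
    also have "\<dots> = (\<bar>C\<bar> * \<bar>C'\<bar> * (2 ^ k)\<^sup>2) * (norm (s + 5) ^ k) ^ 2"
      by (simp add: power_mult_distrib)
    also have "\<dots> \<le> D * (norm (s + 5) ^ k) ^ 2"
      by (intro mult_right_mono) (auto simp: D_def)
    finally show "norm (f s) \<le> D"
      using pos[of s] s unfolding norm_f by (simp add: pos_divide_le_eq)
  next
    fix s :: complex assume s: "\<bar>Re s\<bar> \<le> 3 / 2"
    have "norm (f s) \<le> norm (\<xi> (1 / 2 + s)) / 1"
      unfolding norm_f using norm_5(1)[OF s] by (intro divide_left_mono one_le_power) auto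
    also have "\<dots> = norm (\<xi> (1 / 2 + s))" by simp
    also have "\<dots> \<le> exp (A * (1 + norm s) powr q)" by (rule A) simp
    finally show "norm (f s) \<le> exp (A * (1 + norm s) powr q)" .
  qed (use \<open>D > 0\<close> w in auto)
  then show ?thesis
    using pos[OF w] unfolding norm_f by (simp add: D_def pos_divide_le_eq)
qed

text \<open>Here the unknown order of \<open>G\<close> disappears: right of the strip
  \<open>F\<close> is bounded and \<open>P\<close> has growth \<open>p\<close>, in the strip
  \<open>\<xi>\<close> is polynomially bounded, and the left side is a reflection of the
  right.\<close>

lemma xi_growth: "exp_growth UNIV p \<xi>"
proof -
  have "p \<ge> 0" using p by simp
  have "exp_growth {s. Re s \<ge> 2} p (\<lambda>s. P s * ((s - 1) ^ k * F s))"
    by (intro exp_growth_mult exp_growth_power exp_growth_diff_const exp_growth_mono[OF P_growth]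
          exp_growth_bounded[OF \<open>p \<ge> 0\<close> F_bounded])
       (use p in auto)
  also have "?this \<longleftrightarrow> exp_growth {s. Re s \<ge> 2} p \<xi>"
  proof (rule exp_growth_cong)
    fix s :: complex assume "s \<in> {s. Re s \<ge> 2}"
    then have "Re s > 0" "s \<noteq> 1" by auto
    then show "norm (P s * ((s - 1) ^ k * F s)) = norm (\<xi> s)" by (simp add: xi_eq G_eq)
  qed
  finally have right: "exp_growth {s. Re s \<ge> 2} p \<xi>" .
  have strip: "exp_growth {s. \<bar>Re s - 1 / 2\<bar> \<le> 3 / 2} p \<xi>"
  proof -
    define D where "D = \<bar>C\<bar> * \<bar>C'\<bar> * ((2 ^ k)\<^sup>2) + 1"
    have "exp_growth {s. \<bar>Re s - 1 / 2\<bar> \<le> 3 / 2} p (\<lambda>s. of_real D * ((s - (- (9 / 2))) ^ k) ^ 2)"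
      by (intro exp_growth_mult exp_growth_power exp_growth_diff_const exp_growth_bounded[of p _ _ "\<bar>D\<bar>"])
         (use p in auto)
    then obtain A where "A \<ge> 0" and A: "\<And>s. s \<in> {s. \<bar>Re s - 1 / 2\<bar> \<le> 3 / 2} \<Longrightarrow> norm (of_real D * ((s - (- (9 / 2))) ^ k) ^ 2) \<le> exp (A * (1 + norm s) powr p)"
      by (rule exp_growthE) blast
    show ?thesis
    proof (rule exp_growthI)
      fix s assume "s \<in> {s. \<bar>Re s - 1 / 2\<bar> \<le> 3 / 2}"
      then have s: "\<bar>Re s - 1 / 2\<bar> \<le> 3 / 2" by simp
      have "norm (\<xi> s) \<le> D * (norm (s - 1 / 2 + 5) ^ k) ^ 2"
        using xi_strip_bound[of "s - 1 / 2"] s by (simp add: D_def)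
      also have "\<dots> \<le> norm (of_real D * ((s - (- (9 / 2))) ^ k) ^ 2)"
        by (simp add: norm_mult norm_power mult_right_mono add.commute)
      finally show "norm (\<xi> s) \<le> exp (A * (1 + norm s) powr p)"
        using A[of s] s by simp
    qed
  qed
  have "Re s \<ge> 2 \<or> \<bar>Re s - 1 / 2\<bar> \<le> 3 / 2 \<or> 1 - Re s \<ge> 2" for s
    unfolding abs_le_iff by linarith
  then have "{s. Re s \<ge> 2} \<union> {s. \<bar>Re s - 1 / 2\<bar> \<le> 3 / 2} \<union> {s. 1 - cnj s \<in> {s. Re s \<ge> 2}} = UNIV"
    by auto
  with exp_growth_Un[OF exp_growth_Un[OF right strip] exp_growth_reflect[OF right \<open>p \<ge> 0\<close>]]
  show ?thesis by simp
qed

lemma summable_on_xi_zeros: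
  defines "f \<equiv> (\<lambda>z. \<xi> (1 / 2 - \<i> * z))"
  shows "f holomorphic_on UNIV" "f (\<i> / 2) \<noteq> 0"
    "(\<lambda>\<gamma>. real (nat (zorder f \<gamma>)) / norm \<gamma> ^ 2) summable_on {\<gamma>. f \<gamma> = 0}"
proof -
  have "(\<xi> \<circ> (\<lambda>z. 1 / 2 - \<i> * z)) holomorphic_on UNIV"
    by (rule holomorphic_on_compose_gen[OF _ xi_holomorphic]) (auto intro!: holomorphic_intros)
  then show hol: "f holomorphic_on UNIV" by (simp add: f_def o_def)
  \<comment> \<open>The point \<open>\<i> / 2\<close> corresponds to \<open>s = 1\<close>; it is the
    base point of the zero count.\<close>
  show nz: "f (\<i> / 2) \<noteq> 0"
    using xi_1 by (simp add: f_def)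
  have "exp_growth UNIV p f"
    unfolding f_def
  proof (rule exp_growth_compose[OF xi_growth])
    fix s :: complex
    show "1 + norm (1 / 2 - \<i> * s) \<le> 2 * (1 + norm s)"
      using norm_triangle_ineq4[of "1 / 2" "\<i> * s"] norm_ge_zero[of s] by (simp add: norm_mult del: norm_ge_zero)
  qed (use p in auto)
  then obtain A where "A \<ge> 0" and A: "\<And>z. z \<in> UNIV \<Longrightarrow> norm (f z) \<le> exp (A * (1 + norm z) powr p)"
    by (rule exp_growthE) blast
  then show "(\<lambda>\<gamma>. real (nat (zorder f \<gamma>)) / norm \<gamma> ^ 2) summable_on {\<gamma>. f \<gamma> = 0}"
    using p by (intro summable_on_zeros[OF hol nz, of p A]) auto
qed

end

subsection \<open>Moments on the half line\<close>

text \<open>A measure of its own rather than a set integral, so that termwise integration and norm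
  estimates can be applied without indicator functions.\<close>

definition half_line :: "real measure" where
  "half_line = restrict_space lborel {0<..}"

lemma integrable_half_line_iff:
  fixes f :: "real \<Rightarrow> 'a :: {banach, second_countable_topology}"
  shows "integrable half_line f \<longleftrightarrow> set_integrable lborel {0<..} f"
  unfolding half_line_def set_integrable_def
  by (subst integrable_restrict_space) (auto simp: Int_absorb1)

lemma integral_half_line:
  fixes f :: "real \<Rightarrow> 'a :: {banach, second_countable_topology}"
  shows "integral\<^sup>L half_line f = set_lebesgue_integral lborel {0<..} f"
  unfolding half_line_def set_lebesgue_integral_def
  by (subst integral_restrict_space) (auto simp: Int_absorb1)

lemma space_half_line [simp]: "space half_line = {0<..}"
  by (simp add: half_line_def space_restrict_space)

lemma measurable_half_line: "f \<in> borel_measurable borel \<Longrightarrow> f \<in> borel_measurable half_line"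
  unfolding half_line_def by (rule measurable_restrict_space1) simp

lemma integrable_moment_real:
  fixes a :: real
  assumes "a > 0"
  shows "integrable half_line (\<lambda>t. t ^ k * exp (- a * t))"
proof -
  have "(\<lambda>t. complex_of_real t powr ((of_nat k + 1) - 1) / of_real (exp (a * t)))
          absolutely_integrable_on {0<..}"
    by (rule absolutely_integrable_Gamma_integral) (use assms in auto)
  then have "set_integrable lebesgue {0<..} (\<lambda>t. norm (complex_of_real t powr (of_nat k + 1 - 1) / of_real (exp (a * t))))"
    by (rule set_integrable_norm)
  also have "?this \<longleftrightarrow> set_integrable lebesgue {0<..} (\<lambda>t. t ^ k * exp (- a * t))"
    by (rule set_integrable_cong)
       (auto simp: norm_divide norm_powr_real_powr powr_realpow exp_minus field_simps norm_power)
  finally show ?thesis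
    unfolding integrable_half_line_iff set_integrable_def
    by (subst (asm) integrable_completion) auto
qed

lemma norm_moment:
  assumes "t \<ge> (0::real)"
  shows "norm (of_real (t ^ k) * exp (- z * of_real t)) = t ^ k * exp (- Re z * t)"
  using assms by (simp add: norm_mult norm_power)

lemma integrable_moment:
  assumes "Re z > 0"
  shows "integrable half_line (\<lambda>t. of_real (t ^ k) * exp (- z * of_real t))"
proof (rule Bochner_Integration.integrable_bound[OF integrable_moment_real[of "Re z" k]])
  show "(\<lambda>t. of_real (t ^ k) * exp (- z * of_real t)) \<in> borel_measurable half_line"
    by (rule measurable_half_line) measurable
  show "AE x in half_line. norm (of_real (x ^ k) * exp (- z * of_real x)) \<le> norm (x ^ k * exp (- Re z * x))"
    by (rule AE_I2) (simp add: norm_mult norm_power abs_mult)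
qed (use assms in auto)

lemma tendsto_moment:
  assumes "Re z > 0"
  shows "((\<lambda>t. of_real (t ^ k) * exp (- z * of_real t)) \<longlongrightarrow> 0) at_top"
proof (rule Lim_null_comparison)
  show "\<forall>\<^sub>F t in at_top. norm (of_real (t ^ k) * exp (- z * of_real t)) \<le> (Re z * t) ^ k / exp (Re z * t) / Re z ^ k"
    using eventually_gt_at_top[of 0]
    by eventually_elim (use assms in \<open>simp add: norm_mult norm_power exp_minus field_simps power_mult_distrib norm_divide\<close>)
  have "((\<lambda>t. (Re z * t) ^ k / exp (Re z * t)) \<longlongrightarrow> 0) at_top"
    by (rule filterlim_compose[OF tendsto_power_div_exp_0])
       (rule filterlim_tendsto_pos_mult_at_top[OF tendsto_const assms filterlim_ident])
  from tendsto_divide[OF this tendsto_const[of "Re z ^ k"]] assms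
  show "((\<lambda>t. (Re z * t) ^ k / exp (Re z * t) / Re z ^ k) \<longlongrightarrow> 0) at_top"
    by simp
qed

text \<open>Integration by parts: the integrand is the derivative of
  \<open>- t ^ k * exp (- z * t) / z\<close>, whose boundary value at 0 is nonzero only for
  \<open>k = 0\<close>. In that case the factor \<open>of_nat k\<close> annihilates the term with
  the truncated \<open>k - 1\<close>.\<close>

lemma integral_moment_aux:
  fixes z :: complex
  assumes z: "Re z > 0"
  shows "integral\<^sup>L half_line (\<lambda>t. of_real (t ^ k) * exp (- z * of_real t) - of_nat k / z * (of_real (t ^ (k - 1)) * exp (- z * of_real t)))
          = (if k = 0 then 1 / z else 0)"
proof -
  define f where "f = (\<lambda>t. of_real (t ^ k) * exp (- z * of_real t) - of_nat k / z * (of_real (t ^ (k - 1)) * exp (- z * of_real t)))"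
  define G where "G = (\<lambda>t::real. - (of_real (t ^ k) * exp (- z * of_real t)) / z)"
  have "z \<noteq> 0" using z by auto
  have int: "integrable half_line f"
    unfolding f_def by (intro Bochner_Integration.integrable_diff integrable_mult_right integrable_moment z)
  have "(LBINT x=0..\<infinity>. f x) = 0 - (if k = 0 then - 1 / z else 0)"
  proof (rule interval_integral_FTC_integrable)
    show "(G has_vector_derivative f x) (at x)" for x
    proof -
      have "((\<lambda>s. - (s ^ k * exp (- z * s)) / z) has_field_derivative f x) (at (of_real x))"
        by (rule derivative_eq_intros refl \<open>z \<noteq> 0\<close> | simp add: f_def)+
           (use \<open>z \<noteq> 0\<close> in \<open>simp add: field_simps\<close>)
      from field_vector_diff_chain_at[OF has_vector_derivative_of_real[OF DERIV_ident] this]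
      show ?thesis by (simp add: G_def o_def)
    qed
    show "isCont f x" for x
      unfolding f_def by (intro continuous_intros)
    show "set_integrable lborel (einterval 0 \<infinity>) f"
      using int unfolding integrable_half_line_iff by (simp add: einterval_def greaterThan_def)
    have "(G \<longlongrightarrow> G 0) (at_right 0)"
      using \<open>z \<noteq> 0\<close> unfolding G_def by (intro tendsto_intros) auto
    then show "((G \<circ> real_of_ereal) \<longlongrightarrow> (if k = 0 then - 1 / z else 0)) (at_right 0)"
      unfolding zero_ereal_def ereal_tendsto_simps by (cases k) (simp_all add: G_def)
    have "(G \<longlongrightarrow> - 0 / z) at_top"
      using \<open>z \<noteq> 0\<close> unfolding G_def by (intro tendsto_intros tendsto_moment z)
    then show "((G \<circ> real_of_ereal) \<longlongrightarrow> 0) (at_left \<infinity>)"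
      unfolding ereal_tendsto_simps by simp
  qed auto
  moreover have "(LBINT x=0..\<infinity>. f x) = integral\<^sup>L half_line f"
    by (simp add: integral_half_line interval_lebesgue_integral_def einterval_def greaterThan_def)
  ultimately show ?thesis by (simp add: f_def split: if_splits)
qed

lemma integral_moment:
  fixes z :: complex
  assumes z: "Re z > 0"
  shows "integral\<^sup>L half_line (\<lambda>t. of_real (t ^ k) * exp (- z * of_real t)) = fact k / z ^ Suc k"
proof (induction k)
  case 0
  show ?case using integral_moment_aux[OF z, of 0] by simp
next
  case (Suc k)
  have "z \<noteq> 0" using z by auto
  have "integral\<^sup>L half_line (\<lambda>t. of_real (t ^ Suc k) * exp (- z * of_real t)) =
     of_nat (Suc k) / z * integral\<^sup>L half_line (\<lambda>t. of_real (t ^ k) * exp (- z * of_real t))"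
    using integral_moment_aux[OF z, of "Suc k"] integrable_moment[OF z, of "Suc k"] integrable_moment[OF z, of k]
    by (subst (asm) Bochner_Integration.integral_diff)
       (simp_all del: of_real_power of_real_mult power_Suc add: mult.assoc)
  then show ?case
    unfolding Suc.IH using \<open>z \<noteq> 0\<close> by (simp del: of_real_power)
qed

lemma integrable_indicator_half_line: "integrable half_line (indicator {..b} :: real \<Rightarrow> real)"
  and integral_indicator_half_line: "b \<ge> 0 \<Longrightarrow> integral\<^sup>L half_line (indicator {..b} :: real \<Rightarrow> real) = b"
proof -
  have *: "(\<lambda>t. indicator {0<..} t *\<^sub>R (indicator {..b} t :: real)) = indicator {0<..b}"
    by (auto simp: indicator_def fun_eq_iff)
  show "integrable half_line (indicator {..b} :: real \<Rightarrow> real)"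
    unfolding integrable_half_line_iff set_integrable_def *
    by (cases "b \<ge> 0") (auto simp: integrable_indicator_iff)
  show "integral\<^sup>L half_line (indicator {..b} :: real \<Rightarrow> real) = b" if "b \<ge> 0"
    unfolding integral_half_line set_lebesgue_integral_def * using that by simp
qed

lemma tendsto_quadratic_times_power:
  fixes q :: real
  assumes "0 \<le> q" "q < 1"
  shows "(\<lambda>k. (of_nat k + 1) * (of_nat k + 2) * q ^ Suc k) \<longlonglongrightarrow> 0"
proof (rule Lim_null_comparison)
  \<comment> \<open>The power of \<open>q\<close> is split into two powers of \<open>sqrt q\<close>,
    each of which absorbs one factor \<open>n\<close>.\<close>
  have "(\<lambda>n. of_nat n * sqrt q ^ n) \<longlonglongrightarrow> 0"
    by (rule powser_times_n_limit_0) (use assms in auto)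
  from tendsto_mult[OF this this] have "(\<lambda>n. of_nat n ^ 2 * q ^ n) \<longlonglongrightarrow> 0"
    using assms by (simp add: power2_eq_square power_mult_distrib[symmetric] mult_ac)
  from tendsto_mult[OF tendsto_const[of 2] LIMSEQ_Suc[OF this]]
  show "(\<lambda>k. 2 * (of_nat (Suc k) ^ 2 * q ^ Suc k)) \<longlonglongrightarrow> 0" by simp
  show "\<forall>\<^sub>F k in sequentially. norm ((of_nat k + 1) * (of_nat k + 2) * q ^ Suc k)
          \<le> 2 * (of_nat (Suc k) ^ 2 * q ^ Suc k)"
  proof (intro always_eventually allI)
    fix k :: nat
    have "(real k + 1) * (real k + 2) \<le> 2 * real (Suc k) ^ 2"
      by (simp add: power2_eq_square algebra_simps)
    from mult_right_mono[OF this, of "q ^ Suc k"] assms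
    show "norm ((real k + 1) * (real k + 2) * q ^ Suc k) \<le> 2 * (of_nat (Suc k) ^ 2 * q ^ Suc k)"
      by (simp add: abs_mult mult.assoc)
  qed
qed

subsection \<open>Eventually nonnegative exponential sums\<close>

text \<open>Indices with \<open>m n = 0\<close> are padding, so that any countable set of zeros can
  be listed along the naturals. Assumptions on the location of exponents in the lemmas are therefore
  restricted to \<open>m n > 0\<close>.\<close>

locale exponential_sum =
  fixes m :: "nat \<Rightarrow> nat" and \<rho> :: "nat \<Rightarrow> complex" and a :: real
  assumes summable_weights: "summable (\<lambda>n. real (m n) / norm (\<rho> n) ^ 2)"
    and exponent_nonzero: "\<rho> n \<noteq> 0"
    and Re_exponent_le: "Re (\<rho> n) \<le> 1 / 2"
begin

definition weight :: "nat \<Rightarrow> real" where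
  "weight n = real (m n) / norm (\<rho> n) ^ 2"

definition exp_sum :: "real \<Rightarrow> real" where
  "exp_sum t = a * t ^ 2 + Re (\<Sum>n. of_nat (m n) * ((exp (\<rho> n * of_real t) - 1) / \<rho> n ^ 2))"

text \<open>The \<open>k\<close>-th moment of \<open>exp (e * t) - 1\<close> against
  \<open>exp (- w * t)\<close>, divided by \<open>fact k\<close>: up to sign a Taylor coefficient at
  \<open>w\<close> of \<open>1 / (w - e) - 1 / w\<close>.\<close>

definition pole_diff :: "nat \<Rightarrow> complex \<Rightarrow> complex \<Rightarrow> complex" where
  "pole_diff k w e = 1 / (w - e) ^ Suc k - 1 / w ^ Suc k"

definition moment_term :: "nat \<Rightarrow> complex \<Rightarrow> nat \<Rightarrow> complex" where
  "moment_term k w n =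
     of_nat (m n) / 2 * (pole_diff k w (\<rho> n) / \<rho> n ^ 2 + pole_diff k w (cnj (\<rho> n)) / cnj (\<rho> n) ^ 2)"

text \<open>The quadratic factor is \<open>(k + 2)! / k!\<close>, since \<open>a * t ^ 2\<close>
  raises the order of the moment by 2.\<close>

definition quad_moment :: "nat \<Rightarrow> complex \<Rightarrow> complex" where
  "quad_moment k w = of_real a * ((of_nat k + 1) * (of_nat k + 2)) / w ^ (k + 3)"

text \<open>The \<open>k\<close>-th moment of \<open>exp_sum\<close> over \<open>fact k\<close>.
  This normalization leaves a geometric rate in \<open>k\<close>, up to polynomial factors.\<close>

definition moment :: "nat \<Rightarrow> complex \<Rightarrow> complex" where
  "moment k w = (\<Sum>n. moment_term k w n) + quad_moment k w"

lemma weight_nonneg: "weight n \<ge> 0"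
  by (simp add: weight_def)

lemma summable_weight: "summable weight"
  using summable_weights by (simp add: weight_def[abs_def])

lemma norm_summand_le:
  assumes "t \<ge> 0"
  shows "norm (of_nat (m n) * ((exp (\<rho> n * of_real t) - 1) / \<rho> n ^ 2)) \<le> weight n * (2 * exp (t / 2))"
proof -
  have "norm (exp (\<rho> n * of_real t)) \<le> exp (t / 2)"
    using mult_right_mono[OF Re_exponent_le[of n] assms] by (simp add: mult.commute)
  moreover have "1 \<le> exp (t / 2)" using assms by simp
  ultimately have "norm (exp (\<rho> n * of_real t) - 1) \<le> 2 * exp (t / 2)"
    using norm_triangle_ineq4[of "exp (\<rho> n * of_real t)" 1] unfolding norm_one by linarith
  then have "real (m n) / norm (\<rho> n) ^ 2 * norm (exp (\<rho> n * of_real t) - 1) \<le> real (m n) / norm (\<rho> n) ^ 2 * (2 * exp (t / 2))"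
    by (intro mult_left_mono) auto
  then show ?thesis by (simp add: weight_def norm_mult norm_divide norm_power)
qed

lemma summable_summand:
  assumes "t \<ge> 0"
  shows "summable (\<lambda>n. of_nat (m n) * ((exp (\<rho> n * of_real t) - 1) / \<rho> n ^ 2))"
  by (rule summable_comparison_test'[OF summable_mult2[OF summable_weight, of "2 * exp (t / 2)"]])
     (rule norm_summand_le[OF assms])

lemma abs_exp_sum_le:
  assumes "t \<ge> 0"
  shows "\<bar>exp_sum t\<bar> \<le> \<bar>a\<bar> * t ^ 2 + suminf weight * (2 * exp (t / 2))"
proof -
  have "norm (\<Sum>n. of_nat (m n) * ((exp (\<rho> n * of_real t) - 1) / \<rho> n ^ 2)) \<le> (\<Sum>n. weight n * (2 * exp (t / 2)))"
    by (intro norm_suminf_le norm_summand_le assms summable_mult2 summable_weight)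
  also have "\<dots> = suminf weight * (2 * exp (t / 2))"
    by (rule suminf_mult2[symmetric, OF summable_weight])
  finally have "\<bar>Re (\<Sum>n. of_nat (m n) * ((exp (\<rho> n * of_real t) - 1) / \<rho> n ^ 2))\<bar> \<le> suminf weight * (2 * exp (t / 2))"
    by (rule order_trans[OF abs_Re_le_cmod])
  moreover have "\<bar>a * t ^ 2\<bar> = \<bar>a\<bar> * t ^ 2"
    by (simp add: abs_mult)
  ultimately show ?thesis
    unfolding exp_sum_def
    using abs_triangle_ineq[of "a * t ^ 2" "Re (\<Sum>n. of_nat (m n) * ((exp (\<rho> n * of_real t) - 1) / \<rho> n ^ 2))"]
    by linarith
qed

lemma has_bochner_integral_pole_diff:
  assumes w: "Re w > 1 / 2" and e: "Re e \<le> 1 / 2"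
  shows "has_bochner_integral half_line
           (\<lambda>t. of_real (t ^ k) * exp (- w * of_real t) * (exp (e * of_real t) - 1)) (fact k * pole_diff k w e)"
proof -
  have 1: "has_bochner_integral half_line (\<lambda>t. of_real (t ^ k) * exp (- z * of_real t)) (fact k / z ^ Suc k)"
    if "Re z > 0" for z
    using integrable_moment[OF that] integral_moment[OF that] by (simp add: has_bochner_integral_iff)
  have "has_bochner_integral half_line
     (\<lambda>t. of_real (t ^ k) * exp (- (w - e) * of_real t) - of_real (t ^ k) * exp (- w * of_real t))
     (fact k / (w - e) ^ Suc k - fact k / w ^ Suc k)"
    by (intro has_bochner_integral_diff 1) (use w e in auto)
  moreover have "of_real (t ^ k) * exp (- (w - e) * of_real t) - of_real (t ^ k) * exp (- w * of_real t) =
      of_real (t ^ k) * exp (- w * of_real t) * (exp (e * of_real t) - 1)" for t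
    by (simp add: algebra_simps exp_add[symmetric])
  moreover have "fact k / (w - e) ^ Suc k - fact k / w ^ Suc k = fact k * pole_diff k w e"
    by (simp add: pole_diff_def right_diff_distrib)
  ultimately show ?thesis by (simp only:)
qed

lemma has_bochner_integral_moment_term:
  assumes w: "Re w > 1 / 2"
  shows "has_bochner_integral half_line
           (\<lambda>t. of_real (t ^ k) * exp (- w * of_real t) *
                of_real (Re (of_nat (m n) * ((exp (\<rho> n * of_real t) - 1) / \<rho> n ^ 2)))) (fact k * moment_term k w n)"
proof -
  let ?E = "\<lambda>e t. of_real (t ^ k) * exp (- w * of_real t) * (exp (e * of_real t) - 1)"
  have "has_bochner_integral half_line
     (\<lambda>t. of_nat (m n) / 2 / \<rho> n ^ 2 * ?E (\<rho> n) t + of_nat (m n) / 2 / cnj (\<rho> n) ^ 2 * ?E (cnj (\<rho> n)) t)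
     (of_nat (m n) / 2 / \<rho> n ^ 2 * (fact k * pole_diff k w (\<rho> n))
       + of_nat (m n) / 2 / cnj (\<rho> n) ^ 2 * (fact k * pole_diff k w (cnj (\<rho> n))))"
    by (intro has_bochner_integral_add has_bochner_integral_mult_right has_bochner_integral_pole_diff w)
       (use Re_exponent_le[of n] in auto)
  moreover have "of_nat (m n) / 2 / \<rho> n ^ 2 * ?E (\<rho> n) t + of_nat (m n) / 2 / cnj (\<rho> n) ^ 2 * ?E (cnj (\<rho> n)) t =
      of_real (t ^ k) * exp (- w * of_real t) *
      of_real (Re (of_nat (m n) * ((exp (\<rho> n * of_real t) - 1) / \<rho> n ^ 2)))" for t
  proof -
    define X where "X = exp (\<rho> n * of_real t)"
    have X: "exp (cnj (\<rho> n) * of_real t) = cnj X"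
      by (simp add: X_def exp_cnj)
    define z where "z = of_nat (m n) * ((X - 1) / \<rho> n ^ 2)"
    \<comment> \<open>Taking the real part thus gives half the weight to \<open>\<rho> n\<close> and
      half to its conjugate.\<close>
    have "of_real (Re z) = (z + cnj z) / 2"
      by (simp add: complex_add_cnj)
    then show ?thesis
      unfolding X X_def[symmetric] z_def[symmetric] by (simp add: z_def add_divide_distrib distrib_left mult.commute mult.left_commute)
  qed
  moreover have "of_nat (m n) / 2 / \<rho> n ^ 2 * (fact k * pole_diff k w (\<rho> n))
       + of_nat (m n) / 2 / cnj (\<rho> n) ^ 2 * (fact k * pole_diff k w (cnj (\<rho> n))) = fact k * moment_term k w n"
    by (simp add: moment_term_def algebra_simps)
  ultimately show ?thesis by simp
qed

text \<open>The \<open>n\<close>-th summand is dominated by \<open>weight n\<close> times one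
  integrable function, which justifies termwise integration: summands grow at most like
  \<open>exp (t / 2)\<close>, and \<open>s\<close> is the decay that \<open>exp (- w * t)\<close>
  has left over.\<close>

lemma has_bochner_integral_exp_sum:
  assumes w: "Re w > 1 / 2"
  shows "has_bochner_integral half_line
           (\<lambda>t. of_real (t ^ k) * exp (- w * of_real t) * of_real (exp_sum t)) (fact k * moment k w)"
proof -
  define s where "s = Re w - 1 / 2"
  have "s > 0" using w by (simp add: s_def)
  let ?f = "\<lambda>n t. of_real (t ^ k) * exp (- w * of_real t) *
                of_real (Re (of_nat (m n) * ((exp (\<rho> n * of_real t) - 1) / \<rho> n ^ 2)))"
  note trm = has_bochner_integral_moment_term[OF w]
  have int: "integrable half_line (?f n)" for n
    using trm[of k n] by (simp add: has_bochner_integral_iff)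
  have norm_f: "norm (?f n t) \<le> weight n * (2 * (t ^ k * exp (- s * t)))" if "t > 0" for n t
  proof -
    have "norm (?f n t) = t ^ k * exp (- Re w * t) * \<bar>Re (of_nat (m n) * ((exp (\<rho> n * of_real t) - 1) / \<rho> n ^ 2))\<bar>"
      using that norm_moment[of t k w] by (simp add: norm_mult)
    also have "\<dots> \<le> t ^ k * exp (- Re w * t) * (weight n * (2 * exp (t / 2)))"
      by (rule mult_left_mono[OF order_trans[OF abs_Re_le_cmod norm_summand_le]]) (use that in auto)
    also have "\<dots> = weight n * (2 * (t ^ k * exp (- s * t)))"
      by (simp add: s_def algebra_simps exp_add[symmetric])
    finally show ?thesis .
  qed
  have summ: "summable (\<lambda>n. norm (?f n t))" if "t > 0" for t
    by (rule summable_comparison_test'[OF summable_mult2[OF summable_weight]])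
       (use norm_f[OF that] in auto)
  have summ_int: "summable (\<lambda>n. \<integral>t. norm (?f n t) \<partial>half_line)"
  proof (rule summable_comparison_test'[OF summable_mult2[OF summable_weight]])
    fix n :: nat
    have "norm (\<integral>t. norm (?f n t) \<partial>half_line) = (\<integral>t. norm (?f n t) \<partial>half_line)"
      by simp
    also have "\<dots> \<le> (\<integral>t. weight n * (2 * (t ^ k * exp (- s * t))) \<partial>half_line)"
      by (intro integral_mono_AE integrable_norm int integrable_mult_right integrable_moment_real \<open>s > 0\<close> AE_I2)
         (rule norm_f, simp)
    also have "\<dots> = weight n * (\<integral>t. 2 * (t ^ k * exp (- s * t)) \<partial>half_line)"
      by simp
    finally show "norm (\<integral>t. norm (?f n t) \<partial>half_line) \<le> weight n * (\<integral>t. 2 * (t ^ k * exp (- s * t)) \<partial>half_line)" .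
  qed
  have AE: "AE t in half_line. summable (\<lambda>n. norm (?f n t))"
    by (rule AE_I2) (use summ in auto)
  have i1: "integrable half_line (\<lambda>t. \<Sum>n. ?f n t)"
    by (rule integrable_suminf[OF int AE summ_int])
  have "integral\<^sup>L half_line (\<lambda>t. \<Sum>n. ?f n t) = (\<Sum>n. integral\<^sup>L half_line (?f n))"
    by (rule integral_suminf[OF int AE summ_int])
  also have "\<dots> = (\<Sum>n. fact k * moment_term k w n)"
    using trm[of k] by (intro suminf_cong) (auto simp: has_bochner_integral_iff)
  also have "\<dots> = fact k * (\<Sum>n. moment_term k w n)"
  proof (rule suminf_mult)
    have "summable (\<lambda>n. fact k * moment_term k w n)"
      using sums_integral[OF int AE summ_int] trm[of k] by (auto simp: has_bochner_integral_iff sums_iff)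
    then show "summable (moment_term k w)"
      by (subst (asm) summable_cmult_iff) auto
  qed
  finally have 1: "has_bochner_integral half_line (\<lambda>t. \<Sum>n. ?f n t) (fact k * (\<Sum>n. moment_term k w n))"
    using i1 by (simp add: has_bochner_integral_iff)
  have Suc3: "k + 3 = Suc (k + 2)" by simp
  have 2: "has_bochner_integral half_line (\<lambda>t. of_real a * (of_real (t ^ (k + 2)) * exp (- w * of_real t)))
            (fact k * quad_moment k w)"
  proof -
    have "integrable half_line (\<lambda>t. of_real a * (of_real (t ^ (k + 2)) * exp (- w * of_real t)))"
      by (intro integrable_mult_right integrable_moment) (use w in auto)
    moreover have "integral\<^sup>L half_line (\<lambda>t. of_real a * (of_real (t ^ (k + 2)) * exp (- w * of_real t))) =
        of_real a * (fact (k + 2) / w ^ (k + 3))"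
      unfolding Suc3 using integral_moment[of w "k + 2"] w
      by (subst integral_mult_right_zero) (simp only:)
    moreover have "of_real a * (fact (k + 2) / w ^ (k + 3)) = fact k * quad_moment k w"
      by (simp add: quad_moment_def algebra_simps)
    ultimately show ?thesis
      unfolding has_bochner_integral_iff by (simp only:)
  qed
  have eq: "(\<Sum>n. ?f n t) + of_real a * (of_real (t ^ (k + 2)) * exp (- w * of_real t)) =
      of_real (t ^ k) * exp (- w * of_real t) * of_real (exp_sum t)" if "t > 0" for t
  proof -
    have sm: "summable (\<lambda>n. of_nat (m n) * ((exp (\<rho> n * of_real t) - 1) / \<rho> n ^ 2))"
      using that by (intro summable_summand) auto
    have "(\<Sum>n. ?f n t) = of_real (t ^ k) * exp (- w * of_real t) *
            (\<Sum>n. of_real (Re (of_nat (m n) * ((exp (\<rho> n * of_real t) - 1) / \<rho> n ^ 2))))"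
      by (intro suminf_mult summable_of_real summable_Re sm)
    also have "(\<Sum>n. complex_of_real (Re (of_nat (m n) * ((exp (\<rho> n * of_real t) - 1) / \<rho> n ^ 2)))) =
       of_real (\<Sum>n. Re (of_nat (m n) * ((exp (\<rho> n * of_real t) - 1) / \<rho> n ^ 2)))"
      by (intro suminf_of_real[symmetric] summable_Re sm)
    also have "(\<Sum>n. Re (of_nat (m n) * ((exp (\<rho> n * of_real t) - 1) / \<rho> n ^ 2))) =
        Re (\<Sum>n. (of_nat (m n) * ((exp (\<rho> n * of_real t) - 1) / \<rho> n ^ 2)))"
      by (rule Re_suminf[symmetric, OF sm])
    finally have *: "(\<Sum>n. ?f n t) = of_real (t ^ k) * exp (- w * of_real t) *
      of_real (Re (\<Sum>n. (of_nat (m n) * ((exp (\<rho> n * of_real t) - 1) / \<rho> n ^ 2))))" .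
    show ?thesis
      unfolding exp_sum_def * of_real_add of_real_mult distrib_left power_add
      by (simp add: ac_simps)
  qed
  have "has_bochner_integral half_line (\<lambda>t. (\<Sum>n. ?f n t) + of_real a * (of_real (t ^ (k + 2)) * exp (- w * of_real t)))
     (fact k * moment k w)"
    using has_bochner_integral_add[OF 1 2] by (simp only: moment_def distrib_left)
  also have "?this \<longleftrightarrow> ?thesis"
    by (rule has_bochner_integral_cong[OF refl _ refl]) (rule eq, simp)
  finally show ?thesis .
qed

lemma tendsto_quad_moment:
  assumes "0 \<le> d" "d < norm w"
  shows "(\<lambda>k. d ^ Suc k * norm (quad_moment k w)) \<longlonglongrightarrow> 0"
proof -
  have "norm w > 0" using assms by linarith
  have "(\<lambda>k. \<bar>a\<bar> / norm w ^ 2 * ((of_nat k + 1) * (of_nat k + 2) * (d / norm w) ^ Suc k)) \<longlonglongrightarrow> \<bar>a\<bar> / norm w ^ 2 * 0"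
    by (intro tendsto_mult tendsto_const tendsto_quadratic_times_power)
       (use assms \<open>norm w > 0\<close> in \<open>auto simp: field_simps\<close>)
  also have "(\<lambda>k. \<bar>a\<bar> / norm w ^ 2 * ((of_nat k + 1) * (of_nat k + 2) * (d / norm w) ^ Suc k)) =
      (\<lambda>k. d ^ Suc k * norm (quad_moment k w))"
  proof
    fix k :: nat
    have "norm ((of_nat k + 1) * (of_nat k + 2) :: complex) = (real k + 1) * (real k + 2)"
      using norm_of_nat[of "(k + 1) * (k + 2)", where 'a = complex] by (simp add: norm_mult algebra_simps)
    then show "\<bar>a\<bar> / norm w ^ 2 * ((of_nat k + 1) * (of_nat k + 2) * (d / norm w) ^ Suc k) = d ^ Suc k * norm (quad_moment k w)"
      unfolding quad_moment_def norm_divide norm_mult[of "of_real a"] norm_power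
      using \<open>norm w > 0\<close> by (simp add: power_divide power_add power2_eq_square power3_eq_cube mult_ac)
  qed
  finally show ?thesis by simp
qed

lemma norm_pole_diff_le:
  assumes "D > 0" "D \<le> norm (w - e)" "D \<le> norm w"
  shows "norm (pole_diff k w e) \<le> 2 / D ^ Suc k"
proof -
  have *: "norm (1 / z ^ Suc k) \<le> 1 / D ^ Suc k" if "D \<le> norm z" for z :: complex
    unfolding norm_divide norm_power norm_one
    by (intro divide_left_mono power_mono mult_pos_pos zero_less_power)
       (use that assms(1) in auto)
  show ?thesis
    unfolding pole_diff_def
    using norm_triangle_ineq4[of "1 / (w - e) ^ Suc k" "1 / w ^ Suc k"] *[OF assms(2)] *[OF assms(3)]
    by simp
qed

text \<open>The subtracted 1 in each summand puts a pole at 0 as well; hence the requirement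
  \<open>D \<le> norm w\<close> beside those on the exponents.\<close>

lemma norm_moment_term_le:
  assumes "D > 0" "D \<le> norm w"
    and "m n > 0 \<Longrightarrow> D \<le> norm (w - \<rho> n) \<and> D \<le> norm (w - cnj (\<rho> n))"
  shows "norm (moment_term k w n) \<le> weight n * (2 / D ^ Suc k)"
proof (cases "m n = 0")
  case True
  then show ?thesis by (simp add: moment_term_def weight_def)
next
  case False
  then have D: "norm (pole_diff k w (\<rho> n)) \<le> 2 / D ^ Suc k" "norm (pole_diff k w (cnj (\<rho> n))) \<le> 2 / D ^ Suc k"
    using assms by (auto intro!: norm_pole_diff_le simp del: power_Suc)
  have "norm (pole_diff k w (\<rho> n) / \<rho> n ^ 2 + pole_diff k w (cnj (\<rho> n)) / cnj (\<rho> n) ^ 2)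
        \<le> norm (pole_diff k w (\<rho> n)) / norm (\<rho> n) ^ 2 + norm (pole_diff k w (cnj (\<rho> n))) / norm (\<rho> n) ^ 2"
    by (rule order_trans[OF norm_triangle_ineq]) (simp add: norm_divide norm_power)
  also have "\<dots> \<le> 2 / D ^ Suc k / norm (\<rho> n) ^ 2 + 2 / D ^ Suc k / norm (\<rho> n) ^ 2"
    by (intro add_mono divide_right_mono D) auto
  finally have "real (m n) / 2 * norm (pole_diff k w (\<rho> n) / \<rho> n ^ 2 + pole_diff k w (cnj (\<rho> n)) / cnj (\<rho> n) ^ 2)
     \<le> real (m n) / 2 * (2 / D ^ Suc k / norm (\<rho> n) ^ 2 + 2 / D ^ Suc k / norm (\<rho> n) ^ 2)"
    by (intro mult_left_mono) auto
  also have "\<dots> = weight n * (2 / D ^ Suc k)"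
    by (simp add: weight_def field_simps)
  finally show ?thesis
    by (simp add: moment_term_def norm_mult norm_divide)
qed

text \<open>Cauchy's estimate read off from partial fractions: every pole, including the one at 0,
  is at distance at least \<open>D\<close>. The strict inequality \<open>d < D\<close> absorbs the
  factor quadratic in \<open>k\<close> from \<open>quad_moment\<close>.\<close>

lemma tendsto_moment_away:
  assumes "0 \<le> d" "d < D" "D \<le> norm w"
    and "\<And>n. m n > 0 \<Longrightarrow> D \<le> norm (w - \<rho> n) \<and> D \<le> norm (w - cnj (\<rho> n))"
  shows "(\<lambda>k. d ^ Suc k * norm (moment k w)) \<longlonglongrightarrow> 0"
proof (rule Lim_null_comparison)
  have "D > 0" using assms by linarith
  note le = norm_moment_term_le[OF \<open>D > 0\<close> assms(3,4)]
  show "\<forall>\<^sub>F k in sequentially. norm (d ^ Suc k * norm (moment k w)) \<le>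
     2 * suminf weight * (d / D) ^ Suc k + d ^ Suc k * norm (quad_moment k w)"
  proof (intro always_eventually allI)
    fix k
    have "norm (\<Sum>n. moment_term k w n) \<le> (\<Sum>n. weight n * (2 / D ^ Suc k))"
      by (intro norm_suminf_le le summable_mult2 summable_weight)
    also have "\<dots> = suminf weight * (2 / D ^ Suc k)"
      by (rule suminf_mult2[symmetric, OF summable_weight])
    finally have "norm (moment k w) \<le> suminf weight * (2 / D ^ Suc k) + norm (quad_moment k w)"
      unfolding moment_def using norm_triangle_ineq[of "\<Sum>n. moment_term k w n" "quad_moment k w"] by linarith
    then have "d ^ Suc k * norm (moment k w) \<le> d ^ Suc k * (suminf weight * (2 / D ^ Suc k) + norm (quad_moment k w))"
      using assms(1) by (intro mult_left_mono) auto
    also have "\<dots> = 2 * suminf weight * (d / D) ^ Suc k + d ^ Suc k * norm (quad_moment k w)"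
      by (simp add: power_divide distrib_left)
    finally show "norm (d ^ Suc k * norm (moment k w)) \<le> 2 * suminf weight * (d / D) ^ Suc k + d ^ Suc k * norm (quad_moment k w)"
      using assms(1) by (simp add: abs_mult)
  qed
  have "(\<lambda>k. 2 * suminf weight * (d / D) ^ Suc k + d ^ Suc k * norm (quad_moment k w)) \<longlonglongrightarrow> 2 * suminf weight * 0 + 0"
    by (intro tendsto_intros tendsto_quad_moment LIMSEQ_Suc[OF LIMSEQ_realpow_zero])
       (use assms \<open>D > 0\<close> in auto)
  then show "(\<lambda>k. 2 * suminf weight * (d / D) ^ Suc k + d ^ Suc k * norm (quad_moment k w)) \<longlonglongrightarrow> 0"
    by simp
qed

text \<open>After scaling, a pole further away than \<open>e\<close> contributes a power of a ratio
  of modulus below 1, and \<open>e\<close> itself contributes exactly 1. The pole at 0 counts as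
  further away by the first assumption.\<close>

lemma tendsto_pole_diff:
  assumes "norm (w - e) < norm w" "w \<noteq> e" "norm (w - e) < norm (w - e') \<or> e' = e"
  shows "(\<lambda>k. (w - e) ^ Suc k * pole_diff k w e') \<longlonglongrightarrow> (if e' = e then 1 else 0)"
proof -
  have lim0: "(\<lambda>k. (w - e) ^ Suc k * (1 / z ^ Suc k)) \<longlonglongrightarrow> 0" if "norm (w - e) < norm z" for z :: complex
  proof -
    have "norm ((w - e) / z) < 1" using that by (simp add: norm_divide divide_less_eq)
    from LIMSEQ_Suc[OF LIMSEQ_power_zero[OF this]] show ?thesis
      by (simp add: power_divide)
  qed
  have "(\<lambda>k. (w - e) ^ Suc k * (1 / (w - e') ^ Suc k)) \<longlonglongrightarrow> (if e' = e then 1 else 0)"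
    using lim0[of "w - e'"] assms by (cases "e' = e") auto
  from tendsto_diff[OF this lim0[OF assms(1)]] show ?thesis
    by (simp add: pole_diff_def right_diff_distrib split: if_splits)
qed

text \<open>Tannery's theorem, with the majorant \<open>2 * weight n\<close> uniform in
  \<open>k\<close>. Whether \<open>\<rho> n\<close> or its conjugate equals \<open>e\<close>, the
  denominator becomes \<open>e ^ 2\<close>, so the contributions to the residue are nonnegative
  multiples of one number; a real exponent contributes twice.\<close>

lemma tendsto_moment_pole:
  fixes e w :: complex
  defines "res \<equiv> (\<lambda>n. real (m n) / 2 * ((if \<rho> n = e then 1 else 0) + (if cnj (\<rho> n) = e then 1 else 0)))"
  assumes w: "norm (w - e) < norm w" "w \<noteq> e"
    and near: "\<And>n e'. m n > 0 \<Longrightarrow> e' \<in> {\<rho> n, cnj (\<rho> n)} \<Longrightarrow> norm (w - e) < norm (w - e') \<or> e' = e"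
  shows "(\<lambda>k. (w - e) ^ Suc k * moment k w) \<longlonglongrightarrow> (\<Sum>n. of_real (res n) / e ^ 2)"
    and "summable (\<lambda>n. norm (of_real (res n) / e ^ 2))"
proof -
  define d where "d = norm (w - e)"
  have "d > 0" using w by (simp add: d_def)
  have bound: "norm (moment_term k w n) \<le> weight n * (2 / d ^ Suc k)" for k n
    by (rule norm_moment_term_le) (use \<open>d > 0\<close> w near[of n] in \<open>force simp: d_def\<close>)+
  have lim: "(\<lambda>k. (w - e) ^ Suc k * moment_term k w n) \<longlonglongrightarrow> of_real (res n) / e ^ 2" for n
  proof (cases "m n = 0")
    case True
    then show ?thesis by (simp add: moment_term_def res_def)
  next
    case False
    have "(\<lambda>k. of_nat (m n) / 2 * ((w - e) ^ Suc k * pole_diff k w (\<rho> n) / \<rho> n ^ 2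
             + (w - e) ^ Suc k * pole_diff k w (cnj (\<rho> n)) / cnj (\<rho> n) ^ 2)) \<longlonglongrightarrow>
       of_nat (m n) / 2 * ((if \<rho> n = e then 1 else 0) / \<rho> n ^ 2 + (if cnj (\<rho> n) = e then 1 else 0) / cnj (\<rho> n) ^ 2)"
      by (intro tendsto_mult[OF tendsto_const] tendsto_add tendsto_divide tendsto_const tendsto_pole_diff w near[of n])
         (use False exponent_nonzero[of n] in auto)
    also have "of_nat (m n) / 2 * ((if \<rho> n = e then 1 else 0) / \<rho> n ^ 2 + (if cnj (\<rho> n) = e then 1 else 0) / cnj (\<rho> n) ^ 2)
       = of_real (res n) / e ^ 2"
      by (auto simp: res_def)
    finally show ?thesis
      by (simp add: moment_term_def algebra_simps del: power_Suc)
  qed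
  have *: "eventually (\<lambda>k. summable (\<lambda>n. norm ((w - e) ^ Suc k * moment_term k w n))) sequentially \<and>
      summable (\<lambda>n. norm (of_real (res n) / e ^ 2)) \<and>
      (\<lambda>k. \<Sum>n. (w - e) ^ Suc k * moment_term k w n) \<longlonglongrightarrow> (\<Sum>n. of_real (res n) / e ^ 2)"
  proof (rule tannerys_theorem[where M = "\<lambda>n. weight n * 2"])
    show "\<forall>\<^sub>F (n, k) in sequentially \<times>\<^sub>F sequentially. norm ((w - e) ^ Suc k * moment_term k w n) \<le> weight n * 2"
    proof (rule always_eventually, clarify)
      fix n k
      have "norm ((w - e) ^ Suc k * moment_term k w n) \<le> d ^ Suc k * (weight n * (2 / d ^ Suc k))"
        unfolding norm_mult norm_power d_def[symmetric]
        by (intro mult_left_mono bound) (use \<open>d > 0\<close> in auto)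
      then show "norm ((w - e) ^ Suc k * moment_term k w n) \<le> weight n * 2"
        using \<open>d > 0\<close> by simp
    qed
  qed (auto intro!: lim summable_mult2 summable_weight simp del: power_Suc)
  from * show "summable (\<lambda>n. norm (of_real (res n) / e ^ 2))" by blast
  from * have 1: "(\<lambda>k. \<Sum>n. (w - e) ^ Suc k * moment_term k w n) \<longlonglongrightarrow> (\<Sum>n. of_real (res n) / e ^ 2)" by blast
  have 2: "(\<Sum>n. (w - e) ^ Suc k * moment_term k w n) = (w - e) ^ Suc k * (\<Sum>n. moment_term k w n)" for k
    by (rule suminf_mult, rule summable_comparison_test'[OF summable_mult2[OF summable_weight], OF bound])
  have "(\<lambda>k. norm ((w - e) ^ Suc k * quad_moment k w)) \<longlonglongrightarrow> 0"
    using tendsto_quad_moment[of "norm (w - e)" w] w unfolding norm_mult norm_power by simp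
  then have 3: "(\<lambda>k. (w - e) ^ Suc k * quad_moment k w) \<longlonglongrightarrow> 0"
    by (rule tendsto_norm_zero_cancel)
  show "(\<lambda>k. (w - e) ^ Suc k * moment k w) \<longlonglongrightarrow> (\<Sum>n. of_real (res n) / e ^ 2)"
    using tendsto_add[OF 1 3] unfolding 2 moment_def distrib_left by simp
qed

text \<open>Absolute values turn \<open>exp (- w * t)\<close> into \<open>exp (- Re w * t)\<close>.
  Past \<open>t0\<close> the sum equals its absolute value, which yields the moment at
  \<open>Re w\<close>; before \<open>t0\<close> the two differ by at most \<open>2 * B\<close>, and
  \<open>t ^ k \<le> t0 ^ k\<close> makes the error factorially small after normalization. The
  constant is uniform in \<open>k\<close> and \<open>w\<close>.\<close>

lemma norm_moment_le_real:
  assumes "t0 \<ge> 0" and nonneg: "\<And>t. t \<ge> t0 \<Longrightarrow> exp_sum t \<ge> 0"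
  obtains C where "\<And>k w. Re w > 1 / 2 \<Longrightarrow> norm (moment k w) \<le> norm (moment k (of_real (Re w))) + C * (t0 ^ Suc k / fact k)"
proof
  define B where "B = \<bar>a\<bar> * t0 ^ 2 + suminf weight * (2 * exp (t0 / 2))"
  have sw: "suminf weight \<ge> 0"
    by (intro suminf_nonneg summable_weight weight_nonneg)
  have "B \<ge> 0" using sw by (simp add: B_def)
  have B: "\<bar>exp_sum t\<bar> \<le> B" if "t \<ge> 0" "t \<le> t0" for t
    unfolding B_def
    by (rule order_trans[OF abs_exp_sum_le[OF that(1)]])
       (use that sw in \<open>intro add_mono mult_left_mono power_mono; simp\<close>)
  fix k :: nat and w :: complex
  assume w: "Re w > 1 / 2"
  let ?f = "\<lambda>w t. complex_of_real (t ^ k) * exp (- w * of_real t) * of_real (exp_sum t)"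
  let ?w = "complex_of_real (Re w)"
  have I: "integrable half_line (?f z)" "integral\<^sup>L half_line (?f z) = fact k * moment k z" if "Re z > 1 / 2" for z
    using has_bochner_integral_exp_sum[OF that, of k] by (simp_all add: has_bochner_integral_iff)
  have I_Re: "integrable half_line (\<lambda>t. Re (?f ?w t))"
    by (rule integrable_Re[OF I(1)]) (use w in simp)
  have "norm (fact k * moment k w) \<le> (\<integral>t. norm (?f w t) \<partial>half_line)"
    unfolding I(2)[OF w, symmetric] by (rule integral_norm_bound)
  also have "\<dots> \<le> (\<integral>t. Re (?f ?w t) + 2 * B * t0 ^ k * indicator {..t0} t \<partial>half_line)"
  proof (rule integral_mono_AE)
    show "integrable half_line (\<lambda>t. norm (?f w t))" by (intro integrable_norm I w)
    show "integrable half_line (\<lambda>t. Re (?f ?w t) + 2 * B * t0 ^ k * indicator {..t0} t)"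
      by (intro Bochner_Integration.integrable_add integrable_Re I integrable_mult_right integrable_indicator_half_line)
         (use w in auto)
    show "AE t in half_line. norm (?f w t) \<le> Re (?f ?w t) + 2 * B * t0 ^ k * indicator {..t0} t"
    proof (rule AE_I2)
      fix t assume "t \<in> space half_line"
      then have t: "t > 0" by simp
      have eq: "norm (?f w t) = t ^ k * exp (- Re w * t) * \<bar>exp_sum t\<bar>"
        using norm_moment[of t k w] t by (simp add: norm_mult)
      have "?f ?w t = of_real (t ^ k * exp (- Re w * t) * exp_sum t)"
        by (simp add: exp_of_real[symmetric])
      then have eq': "Re (?f ?w t) = t ^ k * exp (- Re w * t) * exp_sum t"
        by (simp only: Re_complex_of_real)
      show "norm (?f w t) \<le> Re (?f ?w t) + 2 * B * t0 ^ k * indicator {..t0} t"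
      proof (cases "t \<le> t0")
        case True
        have "t ^ k * exp (- Re w * t) \<le> t0 ^ k * 1"
          using True t w by (intro mult_mono power_mono) auto
        then have "t ^ k * exp (- Re w * t) * (\<bar>exp_sum t\<bar> - exp_sum t) \<le> t0 ^ k * (2 * B)"
          using B[of t] t True by (intro mult_mono) (auto simp: \<open>B \<ge> 0\<close>)
        then show ?thesis using True unfolding eq eq' by (simp add: algebra_simps)
      next
        case False
        then show ?thesis using nonneg[of t] unfolding eq eq' by simp
      qed
    qed
  qed
  also have "\<dots> = (\<integral>t. Re (?f ?w t) \<partial>half_line) + 2 * B * t0 ^ k * t0"
    unfolding Bochner_Integration.integral_add[OF I_Re integrable_mult_right[OF integrable_indicator_half_line]]
      integral_mult_right_zero integral_indicator_half_line[OF assms(1)] ..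
  also have "(\<integral>t. Re (?f ?w t) \<partial>half_line) = Re (fact k * moment k ?w)"
    using w by (subst integral_Re[OF I(1)], simp) (subst I(2), simp_all)
  also have "\<dots> \<le> fact k * norm (moment k ?w)"
    using complex_Re_le_cmod[of "fact k * moment k ?w"] by (simp add: norm_mult)
  finally have "fact k * norm (moment k w) \<le> fact k * (norm (moment k ?w) + 2 * B * (t0 ^ Suc k / fact k))"
    by (simp add: norm_mult distrib_left mult_ac)
  then show "norm (moment k w) \<le> norm (moment k ?w) + 2 * B * (t0 ^ Suc k / fact k)"
    by (rule mult_left_le_imp_le) simp
qed

text \<open>Such an index has weight at least \<open>1 / (1 + r ^ 2)\<close>, whereas the weights
  tend to 0. The summand 1 avoids a zero denominator.\<close>

lemma finite_bounded_exponents: "finite {n. m n > 0 \<and> norm (\<rho> n) \<le> r}"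
proof -
  have "(\<lambda>n. real (m n) / norm (\<rho> n) ^ 2) \<longlonglongrightarrow> 0"
    by (rule summable_LIMSEQ_zero[OF summable_weights])
  then have "eventually (\<lambda>n. real (m n) / norm (\<rho> n) ^ 2 < 1 / (1 + r ^ 2)) sequentially"
    by (rule order_tendstoD) (auto intro: add_pos_nonneg)
  then obtain N where N: "\<And>n. n \<ge> N \<Longrightarrow> real (m n) / norm (\<rho> n) ^ 2 < 1 / (1 + r ^ 2)"
    by (auto simp: eventually_sequentially)
  have "{n. m n > 0 \<and> norm (\<rho> n) \<le> r} \<subseteq> {..<N}"
  proof (rule subsetI, rule ccontr)
    fix n assume n: "n \<in> {n. m n > 0 \<and> norm (\<rho> n) \<le> r}" "n \<notin> {..<N}"
    have "norm (\<rho> n) ^ 2 \<le> r ^ 2" using n by (intro power_mono) auto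
    then have "1 * norm (\<rho> n) ^ 2 \<le> real (m n) * (1 + r ^ 2)"
      using n by (intro mult_mono) auto
    then have "1 / (1 + r ^ 2) \<le> real (m n) / norm (\<rho> n) ^ 2"
      using exponent_nonzero[of n] by (simp add: divide_simps add_pos_nonneg)
    then show False using N[of n] n by simp
  qed
  then show ?thesis using finite_subset by blast
qed

text \<open>
  Landau's theorem on Laplace transforms of nonnegative functions, on the level of Taylor
  coefficients.  Suppose that an exponent lies in the forbidden strip, and let \<open>w\<close> be a point with
  \<open>Re w > 1/2\<close> near it, at distance \<open>d\<close> to the nearest exponent \<open>e\<close>.  The \<open>k\<close>-th moment at \<open>w\<close>,
  divided by \<open>k!\<close>, is asymptotic to a nonzero multiple of \<open>(w - e)\<close> to the power \<open>-(k+1)\<close>, since all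
  residues at \<open>e\<close> are nonnegative multiples of \<open>1 / e\<^sup>2\<close>; but up to a small error it is at most
  the moment at \<open>Re w\<close>, which is smaller because every exponent is further than \<open>d\<close> from \<open>Re w\<close>.
\<close>
lemma Re_exponent_gap:
  assumes R: "0 < R" "R \<le> 1" and gap: "\<And>n. m n > 0 \<Longrightarrow> R \<le> norm (\<rho> n - 1 / 2)"
    and "t0 \<ge> 0" and nonneg: "\<And>t. t \<ge> t0 \<Longrightarrow> exp_sum t \<ge> 0"
    and N: "m N > 0"
  shows "Re (\<rho> N) \<le> 1 / 2 - R / 4"
proof (rule ccontr)
  assume not_le: "\<not> Re (\<rho> N) \<le> 1 / 2 - R / 4"
  \<comment> \<open>The point \<open>w1\<close> on the line \<open>1 / 2 + \<eta>\<close> is closer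
    than \<open>2 * \<eta>\<close> to \<open>\<rho> N\<close>, whereas real points between
    \<open>1 / 2\<close> and \<open>1 / 2 + \<eta>\<close> keep distance \<open>3 * \<eta>\<close>
    from all exponents. The threshold \<open>3 / 2 * \<eta>\<close> below separates the two
    situations.\<close>
  define \<eta> where "\<eta> = R / 4"
  have \<eta>: "\<eta> > 0" "\<eta> \<le> 1 / 4" "R = 4 * \<eta>" using R by (auto simp: \<eta>_def)
  have ReN: "Re (\<rho> N) > 1 / 2 - \<eta>" using not_le by (simp add: \<eta>_def)
  define w1 where "w1 = Complex (1 / 2 + \<eta>) (Im (\<rho> N))"
  define E where "E = {e. \<exists>n. m n > 0 \<and> (e = \<rho> n \<or> e = cnj (\<rho> n))}"
  have Re_E: "Re e \<le> 1 / 2" if "e \<in> E" for e using that Re_exponent_le by (auto simp: E_def)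
  have "norm (w1 - \<rho> N) = \<bar>1 / 2 + \<eta> - Re (\<rho> N)\<bar>"
    by (simp add: w1_def norm_complex_def)
  then have near_N: "norm (w1 - \<rho> N) < 2 * \<eta>"
    using ReN Re_exponent_le[of N] \<eta> by linarith
  \<comment> \<open>Only finitely many exponents compete, so a nearest one exists; it need not be
    \<open>\<rho> N\<close>.\<close>
  define E' where "E' = {e \<in> E. norm (w1 - e) < 2 * \<eta>}"
  have "finite E'"
  proof (rule finite_subset)
    let ?S = "{n. m n > 0 \<and> norm (\<rho> n) \<le> norm w1 + 2 * \<eta>}"
    show "E' \<subseteq> \<rho> ` ?S \<union> (\<lambda>n. cnj (\<rho> n)) ` ?S"
    proof
      fix e assume e: "e \<in> E'"
      then obtain n where n: "m n > 0" "e = \<rho> n \<or> e = cnj (\<rho> n)" by (auto simp: E'_def E_def)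
      have "norm e \<le> norm w1 + 2 * \<eta>"
        using e norm_triangle_ineq2[of e w1] by (auto simp: E'_def norm_minus_commute)
      then have "n \<in> ?S" using n by auto
      then show "e \<in> \<rho> ` ?S \<union> (\<lambda>n. cnj (\<rho> n)) ` ?S" using n by blast
    qed
    show "finite (\<rho> ` ?S \<union> (\<lambda>n. cnj (\<rho> n)) ` ?S)"
      using finite_bounded_exponents by blast
  qed
  moreover have "\<rho> N \<in> E'" using near_N N by (auto simp: E'_def E_def)
  ultimately obtain e where e: "e \<in> E'" and min': "\<And>e'. e' \<in> E' \<Longrightarrow> norm (w1 - e) \<le> norm (w1 - e')"
    using arg_min_if_finite[of E' "\<lambda>e. norm (w1 - e)"] arg_min_least[of E' _ "\<lambda>e. norm (w1 - e)"] by blast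
  define d1 where "d1 = norm (w1 - e)"
  have "d1 < 2 * \<eta>" using e by (simp add: E'_def d1_def)
  have "e \<in> E" using e by (simp add: E'_def)
  have min: "d1 \<le> norm (w1 - e')" if "e' \<in> E" for e'
    using min'[of e'] that \<open>d1 < 2 * \<eta>\<close> by (cases "e' \<in> E'") (auto simp: E'_def d1_def)
  have "\<eta> \<le> d1"
    using abs_Re_le_cmod[of "w1 - e"] Re_E[OF \<open>e \<in> E\<close>] by (simp add: d1_def w1_def)
  have "d1 > 0" using \<open>\<eta> \<le> d1\<close> \<eta> by linarith
  \<comment> \<open>Moving towards \<open>e\<close> makes \<open>e\<close> the unique nearest exponent.\<close>
  define w where "w = w1 + (1 / 4) *\<^sub>R (e - w1)"
  have w_e: "w - e = (3 / 4) *\<^sub>R (w1 - e)" by (simp add: w_def algebra_simps scaleR_left_distrib[symmetric])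
  have w1_w: "w1 - w = (1 / 4) *\<^sub>R (w1 - e)" by (simp add: w_def algebra_simps)
  have d: "norm (w - e) = 3 / 4 * d1" unfolding w_e d1_def by simp
  have uniq: "norm (w - e) < norm (w - e') \<or> e' = e" if "e' \<in> E" for e'
  proof (rule ccontr)
    assume "\<not> ?thesis"
    then have le: "norm (w - e') \<le> 3 / 4 * d1" and "e' \<noteq> e" using d by auto
    have n1: "norm (w1 - w) = 1 / 4 * d1" unfolding w1_w d1_def by simp
    have eq: "w1 - e' = (w1 - w) + (w - e')" by simp
    have tri: "norm ((w1 - w) + (w - e')) \<le> norm (w1 - w) + norm (w - e')" by (rule norm_triangle_ineq)
    \<comment> \<open>Equality in the triangle inequality makes \<open>w - e'\<close> parallel to
      \<open>w1 - w\<close>, hence to \<open>w - e\<close>, and the lengths agree too.\<close>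
    have "norm ((w1 - w) + (w - e')) = norm (w1 - w) + norm (w - e')" "norm (w - e') = 3 / 4 * d1"
      using min[OF that] tri n1 le unfolding eq[symmetric] by linarith+
    then have "norm (w1 - w) *\<^sub>R (w - e') = norm (w - e') *\<^sub>R (w1 - w)" "norm (w - e') = 3 / 4 * d1"
      using norm_triangle_eq by blast+
    then have "(1 / 4 * d1) *\<^sub>R (w - e') = (1 / 4 * d1) *\<^sub>R (w - e)"
      unfolding w_e w1_w by (simp add: d1_def mult.commute)
    then have "w - e' = w - e" using \<open>d1 > 0\<close> by simp
    then show False using \<open>e' \<noteq> e\<close> by simp
  qed
  \<comment> \<open>The shift lowers the real part by at most \<open>d1 / 4 < \<eta> / 2\<close>, so
    \<open>w\<close> stays where the moment integrals converge.\<close>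
  have Re_w: "Re w > 1 / 2" "Re w \<le> 1 / 2 + \<eta>"
  proof -
    have "Re w = 1 / 2 + \<eta> - (1 / 4) * Re (w1 - e)" by (simp add: w_def w1_def algebra_simps)
    moreover have "Re (w1 - e) \<le> d1" unfolding d1_def by (rule complex_Re_le_cmod)
    moreover have "Re (w1 - e) \<ge> 0" using Re_E[OF \<open>e \<in> E\<close>] \<eta> by (simp add: w1_def)
    ultimately show "Re w > 1 / 2" "Re w \<le> 1 / 2 + \<eta>" using \<open>d1 < 2 * \<eta>\<close> \<eta> by linarith+
  qed
  have "w \<noteq> e" using Re_w Re_E[OF \<open>e \<in> E\<close>] by auto
  let ?d = "norm (w - e)"
  have d_lt: "?d < 3 / 2 * \<eta>" using d \<open>d1 < 2 * \<eta>\<close> by simp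
  have "?d < norm w"
    using d_lt \<eta> Re_w complex_Re_le_cmod[of w] by linarith
  obtain C where C: "\<And>k w. Re w > 1 / 2 \<Longrightarrow>
      norm (moment k w) \<le> norm (moment k (of_real (Re w))) + C * (t0 ^ Suc k / fact k)"
    using norm_moment_le_real[OF \<open>t0 \<ge> 0\<close> nonneg] by blast
  have lim_real: "(\<lambda>k. ?d ^ Suc k * norm (moment k (of_real (Re w)))) \<longlonglongrightarrow> 0"
  proof (rule tendsto_moment_away)
    show "?d < 3 / 2 * \<eta>" by (rule d_lt)
    \<comment> \<open>The pole at 0 must be far away as well; \<open>\<eta> \<le> 1 / 4\<close>,
      that is \<open>R \<le> 1\<close>, ensures it.\<close>
    show "3 / 2 * \<eta> \<le> norm (complex_of_real (Re w))" using Re_w \<eta> by simp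
    fix n assume n: "m n > 0"
    have R_le: "3 / 2 * \<eta> \<le> norm (of_real (Re w) - \<rho> n)"
    proof -
      have "norm (of_real (Re w) - 1 / 2 :: complex) \<le> \<eta>"
        using Re_w norm_of_real[of "Re w - 1 / 2", where 'a = complex] by simp
      then show ?thesis
        using gap[OF n] norm_triangle_ineq4[of "of_real (Re w) - 1 / 2" "of_real (Re w) - \<rho> n"] \<eta> by simp
    qed
    moreover have "norm (of_real (Re w) - cnj (\<rho> n)) = norm (of_real (Re w) - \<rho> n)"
      using complex_mod_cnj[of "of_real (Re w) - \<rho> n"] by simp
    ultimately show "3 / 2 * \<eta> \<le> norm (of_real (Re w) - \<rho> n) \<and> 3 / 2 * \<eta> \<le> norm (of_real (Re w) - cnj (\<rho> n))"
      by simp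
  qed simp
  have "(\<lambda>k. C * (?d * t0) * ((?d * t0) ^ k / fact k)) \<longlonglongrightarrow> C * (?d * t0) * 0"
    using summable_LIMSEQ_zero[OF summable_exp[of "?d * t0"]]
    by (intro tendsto_mult tendsto_const) (simp add: field_simps)
  then have lim_t0: "(\<lambda>k. C * (?d * t0) * ((?d * t0) ^ k / fact k)) \<longlonglongrightarrow> 0" by simp
  have "(\<lambda>k. (w - e) ^ Suc k * moment k w) \<longlonglongrightarrow> 0"
  proof (rule Lim_null_comparison)
    show "(\<lambda>k. ?d ^ Suc k * norm (moment k (of_real (Re w))) + C * (?d * t0) * ((?d * t0) ^ k / fact k)) \<longlonglongrightarrow> 0"
      using tendsto_add[OF lim_real lim_t0] by simp
    show "\<forall>\<^sub>F k in sequentially. norm ((w - e) ^ Suc k * moment k w) \<le>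
        ?d ^ Suc k * norm (moment k (of_real (Re w))) + C * (?d * t0) * ((?d * t0) ^ k / fact k)"
    proof (intro always_eventually allI)
      fix k
      have "norm ((w - e) ^ Suc k * moment k w) \<le> ?d ^ Suc k * (norm (moment k (of_real (Re w))) + C * (t0 ^ Suc k / fact k))"
        unfolding norm_mult norm_power by (intro mult_left_mono C Re_w) auto
      also have "\<dots> = ?d ^ Suc k * norm (moment k (of_real (Re w))) + C * (?d * t0) * ((?d * t0) ^ k / fact k)"
        unfolding distrib_left power_mult_distrib power_Suc by simp
      finally show "norm ((w - e) ^ Suc k * moment k w) \<le> \<dots>" .
    qed
  qed
  moreover define res where "res = (\<lambda>n. real (m n) / 2 * ((if \<rho> n = e then 1 else 0) + (if cnj (\<rho> n) = e then 1 else 0)))"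
  have near: "norm (w - e) < norm (w - e') \<or> e' = e" if "m n > 0" "e' \<in> {\<rho> n, cnj (\<rho> n)}" for n e'
    using that by (intro uniq) (auto simp: E_def)
  have pole: "(\<lambda>k. (w - e) ^ Suc k * moment k w) \<longlonglongrightarrow> (\<Sum>n. of_real (res n) / e ^ 2)"
      "summable (\<lambda>n. norm (of_real (res n) / e ^ 2))"
    unfolding res_def
    by (rule tendsto_moment_pole, rule \<open>?d < norm w\<close>, rule \<open>w \<noteq> e\<close>, erule near, assumption)+
  ultimately have "(\<Sum>n. of_real (res n) / e ^ 2) = 0"
    using LIMSEQ_unique[OF pole(1)] by simp
  moreover have "(\<Sum>n. of_real (res n) / e ^ 2) = of_real (\<Sum>n. res n) / e ^ 2"
    and "summable res"
  proof -
    have "e \<noteq> 0" using \<open>e \<in> E\<close> exponent_nonzero by (auto simp: E_def)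
    have "summable (\<lambda>n. norm (of_real (res n) / e ^ 2) * norm (e ^ 2))"
      by (rule summable_mult2[OF pole(2)])
    then show "summable res"
      using \<open>e \<noteq> 0\<close> by (intro summable_norm_cancel[of res]) (simp add: norm_divide)
    then show "(\<Sum>n. of_real (res n) / e ^ 2) = of_real (\<Sum>n. res n) / e ^ 2"
      unfolding suminf_of_real[OF \<open>summable res\<close>]
      by (intro suminf_divide summable_of_real)
  qed
  moreover have "(\<Sum>n. res n) > 0"
  proof -
    obtain n where "m n > 0" "e = \<rho> n \<or> e = cnj (\<rho> n)" using \<open>e \<in> E\<close> by (auto simp: E_def)
    then have "res n > 0" by (auto simp: res_def)
    then show ?thesis using \<open>summable res\<close> by (intro suminf_pos2) (auto simp: res_def)
  qed
  moreover have "e \<noteq> 0" using \<open>e \<in> E\<close> exponent_nonzero by (auto simp: E_def)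
  ultimately show False by simp
qed

end

subsection \<open>The screw function of an element of the Selberg class\<close>

lemma Re_pos_not_nonpos_Int: "Re z > 0 \<Longrightarrow> z \<notin> \<int>\<^sub>\<le>\<^sub>0"
  by (auto elim!: nonpos_Ints_cases)

text \<open>On the disc of radius 1 about 1 compactness bounds the quotient; outside, division by
  \<open>s - 1\<close> only decreases the norm. The exponent of the growth bound is kept.\<close>

lemma finite_order_divide_zero:
  assumes "G holomorphic_on UNIV" "finite_order G" "G 1 = 0"
  obtains G' where "G' holomorphic_on UNIV" "finite_order G'" "\<And>s. s \<noteq> 1 \<Longrightarrow> G' s = G s / (s - 1)"
proof
  define G' where "G' = (\<lambda>s. if s = 1 then deriv G 1 else (G s - G 1) / (s - 1))"
  show hol: "G' holomorphic_on UNIV"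
    unfolding G'_def by (rule pole_lemma[OF assms(1)]) simp
  show eq: "G' s = G s / (s - 1)" if "s \<noteq> 1" for s
    using that assms(3) by (simp add: G'_def)
  obtain \<rho> C where C: "\<And>s. norm (G s) \<le> C * exp (norm s powr \<rho>)"
    using assms(2) by (auto simp: finite_order_def)
  have "compact (G' ` cball 1 1)"
    by (intro compact_continuous_image holomorphic_on_imp_continuous_on holomorphic_on_subset[OF hol]) auto
  then obtain B where B: "\<And>s. s \<in> cball 1 1 \<Longrightarrow> norm (G' s) \<le> B"
    using compact_imp_bounded by (force simp: bounded_iff)
  have "norm (G' s) \<le> (\<bar>C\<bar> + \<bar>B\<bar>) * exp (norm s powr \<rho>)" for s
  proof (cases "s \<in> cball 1 1")
    case True
    have "norm (G' s) \<le> \<bar>B\<bar> * 1" using B[OF True] by simp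
    also have "\<dots> \<le> (\<bar>C\<bar> + \<bar>B\<bar>) * exp (norm s powr \<rho>)"
      by (intro mult_mono) auto
    finally show ?thesis .
  next
    case False
    then have "1 < norm (s - 1)" "s \<noteq> 1" by (auto simp: dist_norm norm_minus_commute)
    then have "norm (G' s) \<le> norm (G s) / 1"
      unfolding eq[OF \<open>s \<noteq> 1\<close>] norm_divide by (intro divide_left_mono) auto
    also have "\<dots> \<le> C * exp (norm s powr \<rho>)" using C by simp
    also have "\<dots> \<le> (\<bar>C\<bar> + \<bar>B\<bar>) * exp (norm s powr \<rho>)"
      by (intro mult_right_mono) auto
    finally show ?thesis .
  qed
  then show "finite_order G'" unfolding finite_order_def by (intro exI allI)
qed

text \<open>If \<open>G 1 = 0\<close>, a positive exponent could be lowered by dividing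
  \<open>G\<close> by \<open>s - 1\<close>, against minimality. For exponent 0, \<open>G\<close>
  fills in \<open>F\<close> at 1, and nice meromorphy would make 1 a zero of
  \<open>F\<close>.\<close>

lemma pole_exponent_nonzero_at_1:
  assumes F: "F nicely_meromorphic_on UNIV" and nz: "\<not> is_zero_of F 1"
    and G: "G holomorphic_on UNIV" "finite_order G" "\<And>s. s \<noteq> 1 \<Longrightarrow> G s = (s - 1) ^ pole_exponent F * F s"
  shows "G 1 \<noteq> 0"
proof
  assume "G 1 = 0"
  show False
  proof (cases "pole_exponent F")
    case 0
    have "isCont G 1"
      using holomorphic_on_imp_continuous_on[OF G(1)] by (simp add: continuous_on_eq_continuous_at)
    then have "(G \<longlongrightarrow> G 1) (at 1)" by (simp add: isCont_def)
    then have lim: "(F \<longlongrightarrow> G 1) (at 1)"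
      by (rule Lim_transform_eventually)
         (auto simp: eventually_at_filter G(3) 0 intro!: always_eventually)
    have "\<not> is_pole F 1"
      unfolding is_pole_def using not_tendsto_and_filterlim_at_infinity[OF at_neq_bot lim] by blast
    moreover have "is_pole F 1 \<or> F \<midarrow>1\<rightarrow> F 1"
      using F by (auto simp: nicely_meromorphic_on_def)
    ultimately have "F 1 = G 1" using lim tendsto_unique[OF at_neq_bot] by blast
    then show False using nz \<open>\<not> is_pole F 1\<close> \<open>G 1 = 0\<close> by (simp add: is_zero_of_def)
  next
    case (Suc j)
    obtain G' where G': "G' holomorphic_on UNIV" "finite_order G'" "\<And>s. s \<noteq> 1 \<Longrightarrow> G' s = G s / (s - 1)"
      using finite_order_divide_zero[OF G(1,2) \<open>G 1 = 0\<close>] by blast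
    have "pole_cleared F j"
      unfolding pole_cleared_def
      by (rule exI[of _ G']) (auto simp: G' G(3) Suc)
    then have "pole_exponent F \<le> j" unfolding pole_exponent_def by (rule Least_le)
    then show False using Suc by simp
  qed
qed

lemma norm_dirichlet_term_le:
  assumes "Re s \<ge> 2"
  shows "norm (dirichlet_term a s n) \<le> norm (dirichlet_term a 2 n)"
proof (cases "n = 0")
  case True
  then show ?thesis by (simp add: dirichlet_term_def)
next
  case False
  have "real n powr Re (2 :: complex) \<le> real n powr Re s"
    using False assms by (intro powr_mono) auto
  then have "norm (of_nat n powr 2 :: complex) \<le> norm (of_nat n powr s)"
    using False norm_powr_real_powr[of "complex_of_real (real n)" 2] norm_powr_real_powr[of "complex_of_real (real n)" s]
    by simp
  moreover have "norm (of_nat n powr 2 :: complex) > 0" using False by simp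
  ultimately show ?thesis
    unfolding dirichlet_term_def norm_divide by (intro divide_left_mono mult_pos_pos) auto
qed

lemma selberg_class_completed:
  assumes "F \<in> selberg_class" and nz: "\<not> is_zero_of F 1"
  obtains P G \<omega> k C C' where "completed_L_function (xi F) P G F \<omega> (3 / 2) k C C'"
proof -
  have F: "F nicely_meromorphic_on UNIV"
    using assms(1) unfolding selberg_class_def mem_Collect_eq by (elim conjE)
  have "\<exists>a. (\<forall>s. Re s > 1 \<longrightarrow> summable (\<lambda>n. norm (dirichlet_term a s n)) \<and> dirichlet_term a s sums F s) \<and>
      (\<exists>m. pole_cleared F m) \<and> (\<exists>\<xi>. is_xi F \<xi>) \<and> (\<forall>s. Re s > 1 \<longrightarrow> (\<exists>L. exp L = F s))"
    using assms(1) unfolding selberg_class_def mem_Collect_eq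
    by (elim conjE exE) (rule exI, intro conjI, assumption, blast, blast, blast)
  then obtain a where a: "\<forall>s. Re s > 1 \<longrightarrow> summable (\<lambda>n. norm (dirichlet_term a s n)) \<and> dirichlet_term a s sums F s"
    and cleared: "\<exists>m. pole_cleared F m" and xi: "\<exists>\<xi>. is_xi F \<xi>"
    and log: "\<forall>s. Re s > 1 \<longrightarrow> (\<exists>L. exp L = F s)"
    by (elim exE conjE) (rule that, assumption, blast, blast, assumption)
  define k where "k = pole_exponent F"
  have "pole_cleared F k" unfolding k_def pole_exponent_def by (rule LeastI_ex[OF cleared])
  then obtain G where G: "G holomorphic_on UNIV" "finite_order G" "\<And>s. s \<noteq> 1 \<Longrightarrow> G s = (s - 1) ^ k * F s"
    unfolding pole_cleared_def by blast
  have "is_xi F (xi F)" unfolding xi_def by (rule someI_ex[OF xi])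
  then obtain r Q l \<mu> \<omega> where Q: "Q > 0" and l: "\<And>j. j \<in> {1..r} \<Longrightarrow> l j > 0" "\<And>j. j \<in> {1..r} \<Longrightarrow> Re (\<mu> j) \<ge> 0"
    and \<omega>: "norm \<omega> = 1" and \<xi>: "xi F = xi_of_data F r Q l \<mu>" and fe: "\<And>s. xi F s = \<omega> * cnj (xi F (1 - cnj s))"
    unfolding is_xi_def by blast
  \<comment> \<open>The factor \<open>(s - 1) ^ k\<close> is left to \<open>G\<close>, where it
    clears the pole of \<open>F\<close>; what remains has neither zeros nor poles on
    \<open>Re s > 0\<close>.\<close>
  define P where "P = (\<lambda>s. s ^ k * of_real Q powr s * (\<Prod>j=1..r. Gamma (of_real (l j) * s + \<mu> j)))"
  have arg_pos: "Re (of_real (l j) * s + \<mu> j) > 0" if "j \<in> {1..r}" "Re s > 0" for j s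
    using l[OF that(1)] that(2) by (simp add: add_pos_nonneg)
  have P_hol: "P holomorphic_on {s. Re s > 0}"
  proof -
    have "(\<lambda>s. Gamma (of_real (l j) * s + \<mu> j)) holomorphic_on {s. Re s > 0}" if "j \<in> {1..r}" for j
    proof (rule holomorphic_Gamma')
      show "(\<lambda>s. of_real (l j) * s + \<mu> j) holomorphic_on {s. Re s > 0}" by (intro holomorphic_intros)
      show "of_real (l j) * s + \<mu> j \<notin> \<int>\<^sub>\<le>\<^sub>0" if "s \<in> {s. Re s > 0}" for s
        using that by (intro Re_pos_not_nonpos_Int arg_pos[OF \<open>j \<in> {1..r}\<close>]) simp
    qed
    then have "(\<lambda>s. \<Prod>j=1..r. Gamma (of_real (l j) * s + \<mu> j)) holomorphic_on {s. Re s > 0}"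
      by (rule holomorphic_on_prod)
    moreover have "(\<lambda>s. of_real Q powr s) = (\<lambda>s. exp (s * ln (complex_of_real Q)))"
      using Q by (simp add: powr_def)
    then have "(\<lambda>s. s ^ k * of_real Q powr s) holomorphic_on {s. Re s > 0}"
      by (simp only:) (intro holomorphic_intros)
    ultimately show ?thesis unfolding P_def by (rule holomorphic_on_mult[rotated])
  qed
  let ?C = "Q powr 2 * (\<Prod>j=1..r. Gamma (l j * 2 + Re (\<mu> j)))"
  have "completed_L_function (xi F) P G F \<omega> (3 / 2) k ?C (\<Sum>n. norm (dirichlet_term a 2 n))"
  proof
    show "P holomorphic_on {s. Re s > 0}" by (rule P_hol)
    show "P s \<noteq> 0" if "Re s > 0" for s
    proof -
      have "s \<noteq> 0" using that by auto
      moreover have "Gamma (of_real (l j) * s + \<mu> j) \<noteq> 0" if "j \<in> {1..r}" for j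
        using Re_pos_not_nonpos_Int[OF arg_pos[OF that \<open>Re s > 0\<close>]] by (simp add: Gamma_eq_zero_iff)
      ultimately show ?thesis using Q by (simp add: P_def)
    qed
    show "exp_growth {s. Re s \<ge> 1 / 2} (3 / 2) P"
      unfolding P_def
      using exp_growth_diff_const[of "3 / 2" "{s. Re s \<ge> 1 / 2}" 0] l Q
      by (intro exp_growth_mult exp_growth_power exp_growth_powr exp_growth_prod exp_growth_Gamma) auto
    show "norm (P s) \<le> ?C * (1 + norm s) ^ k" if "Re s = 2" for s
    proof -
      have "norm (of_real Q powr s) = Q powr 2"
        using Q that by (simp add: norm_powr_real_powr)
      moreover have "norm (\<Prod>j=1..r. Gamma (of_real (l j) * s + \<mu> j)) \<le> (\<Prod>j=1..r. Gamma (l j * 2 + Re (\<mu> j)))"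
        unfolding prod_norm[symmetric]
      proof (intro prod_mono conjI norm_ge_zero)
        fix j assume "j \<in> {1..r}"
        from norm_Gamma_le[OF arg_pos[OF this, of s]] that
        show "norm (Gamma (of_real (l j) * s + \<mu> j)) \<le> Gamma (l j * 2 + Re (\<mu> j))" by simp
      qed
      moreover have "norm s ^ k \<le> (1 + norm s) ^ k" by (intro power_mono) auto
      ultimately have "norm (P s) \<le> (1 + norm s) ^ k * Q powr 2 * (\<Prod>j=1..r. Gamma (l j * 2 + Re (\<mu> j)))"
        unfolding P_def norm_mult norm_power by (intro mult_mono) auto
      then show ?thesis by (simp add: mult_ac)
    qed
    show "G 1 \<noteq> 0"
      using pole_exponent_nonzero_at_1[OF F nz G(1,2)] G(3) unfolding k_def by blast
    show "norm (F s) \<le> (\<Sum>n. norm (dirichlet_term a 2 n))" if "Re s \<ge> 2" for s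
    proof -
      have "Re s > 1" using that by simp
      have "F s = (\<Sum>n. dirichlet_term a s n)" using a \<open>Re s > 1\<close> sums_unique by blast
      then show ?thesis
        using norm_suminf_le[of "dirichlet_term a s" "\<lambda>n. norm (dirichlet_term a 2 n)", OF norm_dirichlet_term_le[OF that]] a
        by simp
    qed
    show "F s \<noteq> 0" if "Re s > 1" for s
      using log that exp_not_eq_zero by metis
    show "xi F s = P s * G s" if "Re s > 0" for s
    proof -
      \<comment> \<open>\<open>remove_sings\<close> assigns limits, so the value at \<open>s\<close>
        is computed from a punctured neighbourhood. This includes \<open>s = 1\<close>, where
        \<open>F\<close> may have a pole.\<close>
      have "isCont P s"
        using holomorphic_on_imp_continuous_on[OF P_hol] that
        by (simp add: continuous_on_eq_continuous_at open_halfspace_Re_gt)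
      moreover have "isCont G s"
        using holomorphic_on_imp_continuous_on[OF G(1)] by (simp add: continuous_on_eq_continuous_at)
      ultimately have "((\<lambda>w. P w * G w) \<longlongrightarrow> P s * G s) (at s)"
        unfolding isCont_def by (rule tendsto_mult)
      moreover have "eventually (\<lambda>w. w \<noteq> 1) (at s)"
        by (rule eventually_neq_at_within)
      then have "eventually (\<lambda>w. P w * G w = w ^ pole_exponent F * (w - 1) ^ pole_exponent F * of_real Q powr w *
            (\<Prod>j=1..r. Gamma (of_real (l j) * w + \<mu> j)) * F w) (at s)"
        by eventually_elim (simp add: P_def G(3) k_def mult_ac)
      ultimately have "((\<lambda>w. w ^ pole_exponent F * (w - 1) ^ pole_exponent F * of_real Q powr w *
            (\<Prod>j=1..r. Gamma (of_real (l j) * w + \<mu> j)) * F w) \<longlongrightarrow> P s * G s) (at s)"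
        by (rule Lim_transform_eventually)
      then show ?thesis unfolding \<xi> xi_of_data_def by (rule remove_sings_eqI)
    qed
    show "G s = (s - 1) ^ k * F s" if "s \<noteq> 1" for s by (rule G(3)[OF that])
    show "xi F s = \<omega> * cnj (xi F (1 - cnj s))" for s by (rule fe)
  qed (simp_all add: G \<omega>)
  then show ?thesis by (rule that)
qed

text \<open>Bridge from unordered sums over zeros to series over the naturals. The value 0 off the
  image of \<open>to_nat_on\<close> covers finite \<open>Z\<close>.\<close>

lemma has_sum_imp_sums_to_nat_on:
  fixes h :: "'a \<Rightarrow> 'b :: {comm_monoid_add, t2_space}"
  assumes "countable Z" "(h has_sum S) Z"
  shows "(\<lambda>n. if n \<in> to_nat_on Z ` Z then h (from_nat_into Z n) else 0) sums S"
proof -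
  have "((h \<circ> from_nat_into Z) \<circ> to_nat_on Z has_sum S) Z"
    using assms by (subst has_sum_cong[where g = h]) auto
  then have "((h \<circ> from_nat_into Z) has_sum S) (to_nat_on Z ` Z)"
    by (subst has_sum_reindex) (auto intro: inj_on_to_nat_on assms)
  then have "((\<lambda>n. if n \<in> to_nat_on Z ` Z then h (from_nat_into Z n) else 0) has_sum S) UNIV"
    by (subst has_sum_cong_neutral[where g = "h \<circ> from_nat_into Z" and T = "to_nat_on Z ` Z"]) auto
  then show ?thesis by (rule has_sum_imp_sums)
qed

theorem corollary1p1:
  fixes F :: "complex \<Rightarrow> complex"
  assumes "F \<in> selberg_class"
    and "\<exists>t0\<ge>0. \<forall>t\<ge>t0. Re (- screw_function F t) \<ge> 0"
    and "\<not> is_zero_of F 1"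
  shows "\<exists>\<delta>>0. \<forall>s. Re s > 1 - \<delta> \<longrightarrow> \<not> is_zero_of F s"
proof -
  obtain P G \<omega> k C C' where "completed_L_function (xi F) P G F \<omega> (3 / 2) k C C'"
    using selberg_class_completed[OF assms(1,3)] by blast
  then interpret L: completed_L_function "xi F" P G F \<omega> "3 / 2" k C C' .
  obtain t0 where t0: "t0 \<ge> 0" "\<And>t. t \<ge> t0 \<Longrightarrow> Re (- screw_function F t) \<ge> 0"
    using assms(2) by blast
  define f where "f = (\<lambda>z. xi F (1 / 2 - \<i> * z))"
  have zeros: "xi_zeros F = {\<gamma>. f \<gamma> = 0}" by (simp add: xi_zeros_def f_def)
  have mult: "xi_mult F \<gamma> = nat (zorder f \<gamma>)" if "\<gamma> \<in> xi_zeros F" for \<gamma>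
    using that by (simp add: xi_mult_def f_def)
  have f: "f holomorphic_on UNIV" "f (\<i> / 2) \<noteq> 0"
      "(\<lambda>\<gamma>. real (nat (zorder f \<gamma>)) / norm \<gamma> ^ 2) summable_on {\<gamma>. f \<gamma> = 0}"
    unfolding f_def by (rule L.summable_on_xi_zeros)+
  have mult_pos: "xi_mult F \<gamma> > 0" if "\<gamma> \<in> xi_zeros F" for \<gamma>
  proof -
    have "\<exists>w\<in>UNIV. f w \<noteq> 0" using f(2) by blast
    from zorder_exist_zero[OF f(1) open_UNIV connected_UNIV UNIV_I this, of \<gamma>] that
    show ?thesis unfolding mult[OF that] by (simp add: zeros)
  qed
  define Z where "Z = xi_zeros F - {0}"
  let ?v = "\<lambda>\<gamma>. real (xi_mult F \<gamma>) / norm \<gamma> ^ 2"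
  have "?v summable_on xi_zeros F"
    using f(3) unfolding zeros[symmetric] by (subst summable_on_cong[where g = "\<lambda>\<gamma>. real (nat (zorder f \<gamma>)) / norm \<gamma> ^ 2"]) (simp_all add: mult)
  then have v: "?v summable_on Z" by (rule summable_on_subset) (auto simp: Z_def)
  \<comment> \<open>A summable family has only countably many nonzero members, and every zero has
    positive weight.\<close>
  have "countable Z"
  proof -
    have "(\<lambda>\<gamma>. norm (?v \<gamma>)) summable_on Z" using v by simp
    from abs_summable_countable[OF this] have "countable {\<gamma> \<in> Z. ?v \<gamma> \<noteq> 0}" .
    also have "{\<gamma> \<in> Z. ?v \<gamma> \<noteq> 0} = Z" using mult_pos by (force simp: Z_def)
    finally show ?thesis .
  qed
  define I where "I = to_nat_on Z ` Z"
  define m where "m = (\<lambda>n. if n \<in> I then xi_mult F (from_nat_into Z n) else 0)"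
  \<comment> \<open>The filler \<open>- 1\<close> is nonzero with real part below 1/2, as the locale
    requires of all indices.\<close>
  define \<rho> where "\<rho> = (\<lambda>n. if n \<in> I then - \<i> * from_nat_into Z n else - 1)"
  have from_Z: "from_nat_into Z n \<in> Z" if "n \<in> I" for n
    using that \<open>countable Z\<close> by (auto simp: I_def)
  have zero_strip: "Im \<gamma> \<le> 1 / 2" if "\<gamma> \<in> Z" for \<gamma>
    using L.xi_nonzero_right[of "1 / 2 - \<i> * \<gamma>"] that by (force simp: Z_def xi_zeros_def)
  define a where "a = real (xi_mult F 0) / 2"
  interpret E: exponential_sum m \<rho> a
  proof
    have "(\<lambda>n. if n \<in> I then ?v (from_nat_into Z n) else 0) sums infsum ?v Z"
      unfolding I_def by (intro has_sum_imp_sums_to_nat_on \<open>countable Z\<close> has_sum_infsum v)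
    moreover have "(\<lambda>n. if n \<in> I then ?v (from_nat_into Z n) else 0) = (\<lambda>n. real (m n) / norm (\<rho> n) ^ 2)"
      by (auto simp: m_def \<rho>_def fun_eq_iff norm_mult)
    ultimately show "summable (\<lambda>n. real (m n) / norm (\<rho> n) ^ 2)" by (simp only: sums_iff)
    show "\<rho> n \<noteq> 0" for n using from_Z[of n] by (auto simp: \<rho>_def Z_def)
    show "Re (\<rho> n) \<le> 1 / 2" for n using zero_strip[OF from_Z[of n]] by (simp add: \<rho>_def)
  qed
  \<comment> \<open>The minus sign is that of \<open>\<rho> n ^ 2 = - (\<gamma> ^ 2)\<close>; it
    produces the minus in \<open>- screw_function F t\<close>.\<close>
  have summand: "of_nat (m n) * ((exp (\<rho> n * of_real t) - 1) / \<rho> n ^ 2) =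
      (if n \<in> I then - (of_nat (xi_mult F (from_nat_into Z n)) *
        ((exp (- \<i> * from_nat_into Z n * of_real t) - 1) / from_nat_into Z n ^ 2)) else 0)" for n t
    by (simp add: m_def \<rho>_def power_mult_distrib)
  have screw: "E.exp_sum t = Re (- screw_function F t)" if "t \<ge> 0" for t
  proof -
    let ?h = "\<lambda>\<gamma>. of_nat (xi_mult F \<gamma>) * ((exp (- \<i> * \<gamma> * of_real t) - 1) / \<gamma> ^ 2)"
    \<comment> \<open>Summability has to be established here, because \<open>infsum\<close> is 0 by
      convention on a family that is not summable.\<close>
    have "(\<lambda>\<gamma>. norm (?h \<gamma>)) summable_on Z"
    proof (rule Infinite_Sum.abs_summable_on_comparison_test')
      show "(\<lambda>\<gamma>. ?v \<gamma> * (2 * exp (t / 2))) summable_on Z" by (rule summable_on_cmult_left[OF v])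
      fix \<gamma> assume "\<gamma> \<in> Z"
      then have n: "to_nat_on Z \<gamma> \<in> I" "from_nat_into Z (to_nat_on Z \<gamma>) = \<gamma>"
        using \<open>countable Z\<close> by (auto simp: I_def)
      then have "norm (?h \<gamma>) = norm (of_nat (m (to_nat_on Z \<gamma>)) * ((exp (\<rho> (to_nat_on Z \<gamma>) * of_real t) - 1) / \<rho> (to_nat_on Z \<gamma>) ^ 2))"
        unfolding summand by simp
      also have "\<dots> \<le> E.weight (to_nat_on Z \<gamma>) * (2 * exp (t / 2))" by (rule E.norm_summand_le[OF that])
      also have "E.weight (to_nat_on Z \<gamma>) = ?v \<gamma>"
        unfolding E.weight_def using n by (simp add: m_def \<rho>_def norm_mult)
      finally show "norm (?h \<gamma>) \<le> ?v \<gamma> * (2 * exp (t / 2))" .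
    qed
    then have "?h summable_on Z" by (rule abs_summable_summable)
    then have "(?h has_sum infsum ?h Z) Z" by (rule has_sum_infsum)
    then have "(\<lambda>n. if n \<in> I then ?h (from_nat_into Z n) else 0) sums infsum ?h Z"
      unfolding I_def by (intro has_sum_imp_sums_to_nat_on \<open>countable Z\<close>)
    from sums_minus[OF this]
    have "(\<lambda>n. of_nat (m n) * ((exp (\<rho> n * of_real t) - 1) / \<rho> n ^ 2)) sums (- infsum ?h Z)"
      unfolding summand by (rule sums_cong[THEN iffD1, rotated]) simp
    then have "(\<Sum>n. of_nat (m n) * ((exp (\<rho> n * of_real t) - 1) / \<rho> n ^ 2)) = - infsum ?h Z"
      by (rule sums_unique[symmetric])
    \<comment> \<open>\<open>screw_B F\<close> is a real number, so its term is purely imaginary and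
      drops out of the real part.\<close>
    moreover have "screw_function F t = - \<i> * of_real (screw_B F) * of_real t - of_real (a * t ^ 2) + infsum ?h Z"
      by (simp add: screw_function_def a_def Z_def)
    ultimately show ?thesis unfolding E.exp_sum_def by simp
  qed
  have "open {s. xi F s \<noteq> 0}"
    using holomorphic_on_imp_continuous_on[OF L.xi_holomorphic] by (intro open_Collect_neq) auto
  then obtain R0 where R0: "R0 > 0" "ball 1 R0 \<subseteq> {s. xi F s \<noteq> 0}"
    using L.xi_1 by (auto simp: open_contains_ball)
  define R where "R = min R0 1"
  have R: "0 < R" "R \<le> 1" using R0 by (auto simp: R_def)
  have gap: "R \<le> norm (\<rho> n - 1 / 2)" if "m n > 0" for n
  proof -
    have "n \<in> I" using that by (auto simp: m_def split: if_splits)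
    then have "xi F (1 / 2 + \<rho> n) = 0" using from_Z[of n] by (simp add: \<rho>_def Z_def xi_zeros_def)
    then have "1 / 2 + \<rho> n \<notin> ball 1 R0" using R0 by auto
    moreover have "dist 1 (1 / 2 + \<rho> n) = norm (\<rho> n - 1 / 2)"
      by (simp add: dist_norm norm_minus_commute)
    ultimately show ?thesis by (simp add: R_def)
  qed
  have "\<not> is_zero_of F s" if s: "Re s > 1 - R / 4" for s
  proof
    assume zero: "is_zero_of F s"
    then have "s \<noteq> 1" "F s = 0" using assms(3) by (auto simp: is_zero_of_def)
    then have "xi F s = 0" using s R by (intro L.xi_zero_if_F_zero) auto
    define \<gamma> where "\<gamma> = \<i> * (s - 1 / 2)"
    have s_eq: "1 / 2 - \<i> * \<gamma> = s" by (simp add: \<gamma>_def algebra_simps)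
    \<comment> \<open>\<open>R \<le> 1\<close> gives \<open>Re s > 3 / 4\<close>; so
      \<open>\<gamma>\<close> is not the zero at the origin, which \<open>Z\<close> leaves
      out.\<close>
    have "Re s \<noteq> 1 / 2" using s R by linarith
    then have "\<gamma> \<noteq> 0" using s_eq by auto
    then have "\<gamma> \<in> Z" using \<open>xi F s = 0\<close> s_eq by (simp add: Z_def xi_zeros_def)
    define n where "n = to_nat_on Z \<gamma>"
    have n: "n \<in> I" "from_nat_into Z n = \<gamma>"
      using \<open>\<gamma> \<in> Z\<close> \<open>countable Z\<close> by (auto simp: I_def n_def)
    have "m n > 0" using n mult_pos[of \<gamma>] \<open>\<gamma> \<in> Z\<close> by (simp add: m_def Z_def)
    have "E.exp_sum t \<ge> 0" if "t \<ge> t0" for t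
      using screw[of t] t0 that by simp
    from E.Re_exponent_gap[OF R gap t0(1) this \<open>m n > 0\<close>] have "Re (\<rho> n) \<le> 1 / 2 - R / 4" .
    moreover have "\<rho> n = s - 1 / 2" using n by (simp add: \<rho>_def s_eq[symmetric])
    ultimately show False using s by simp
  qed
  then show ?thesis using R by (intro exI[of _ "R / 4"]) auto
qed

end
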